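(* Let $\mathfrak W=\langle\langle\mathfrak M,\gamma\rangle,\rho,X,\mathfrak R\rangle$ and let $\langle\mathfrak V,\mathfrak W;X,\mathbb R^+\rangle$ be a $(\Theta,\mathcal E)$-structure such that for all $x\in X$, $\mathfrak E_x$ is a reflexive Banach space, $S_x\subseteq\mathcal P_\omega(\mathfrak E_x)$ and $$\mathfrak M_x\subseteq\Bigl\{F\in\mathcal C(\mathbb R^+,\mathcal L_{S_x}(\mathfrak E_x)):\ \forall\lambda>0,\ \int^*_{\mathbb R^+}e^{-\lambda s}\|F(s)\|_{B(\mathfrak E_x)}\,ds<\infty\Bigr\}.$$ Then $$\mathfrak M_x\subset\bigcap_{\lambda>0}\mathfrak L_1(\mathbb R^+,\mathcal L_{S_x}(\mathfrak E_x);\mu_\lambda)\qquad\text{for all }x\in X.$$ In particular this inclusion and $\mathsf U_{\|\cdot\|_{B(\mathfrak E_x)}}(\mathcal L_{S_x}(\mathfrak E_x))\subseteq\mathfrak M_x$ hold if for every $x\in X$ $$\mathfrak M_x=\Bigl\{F\in\mathcal C_c(\mathbb R^+,\mathcal L_{S_x}(\mathfrak E_x)):\ \sup_{s\in\mathbb R^+}\|F(s)\|_{B(\mathfrak E_x)}<\infty\Bigr\}.$$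
   Context: Vector spaces are over $\mathbb C$; $\mathbb R^+=[0,\infty[$; $\mathcal P_\omega(A)$ is the set of finite subsets of $A$; $\int^*$ is the upper integral; $\mu_\lambda$ is the Radon measure $e^{-\lambda s}ds$ on $\mathbb R^+$. For a locally compact space $Y$, a Radon measure $\mu$ on $Y$ and a Hausdorff locally convex space $E$, $\mathfrak L_1(Y,E;\mu)$ is the space of scalarly essentially $\mu$-integrable maps $Y\to E$ whose (weak) integral belongs to $E$ (Bourbaki). $\mathcal C_c$ means continuous maps with the topology of compact convergence. $\mathcal L_{S}(E)$ is the space of continuous linear endomorphisms with uniform convergence on the members of $S$. $\mathsf U_{\|\cdot\|_{B(E)}}(\mathcal L_S(E))$ is the set of continuous semigroup morphisms $U:\mathbb R^+\to\mathcal L_S(E)$ with $\|U(s)\|_{B(E)}\le1$ for all $s$. Bundles. A bundle of $\Omega$-spaces $\langle\langle\mathfrak E,\tau\rangle,\pi,X,\mathfrak N\rangle$ (Gierz) consists of topological spaces $\langle\mathfrak E,\tau\rangle$ and $X$, a continuous open surjection $\pi:\mathfrak E\to X$, a vector space structure on each stalk $\mathfrak E_x=\pi^{-1}(x)$ such that addition $\{(a,b):\pi(a)=\pi(b)\}\to\mathfrak E$ and scalar multiplication are continuous, and a set $\mathfrak N=\{\nu_j:j\in J\}$ of functions $\mathfrak E\to[0,\infty[$ whose restrictions to each $\mathfrak E_x$ form a directed family of seminorms generating the (Hausdorff) topology induced by $\tau$ on $\mathfrak E_x$. $\Gamma_U(\pi)$ is the set of continuous sections $\sigma$ over $U\subseteq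 X$ with $\sup_{x\in U}\nu_j(\sigma(x))<\infty$ for all $j$; $\Gamma(\pi)=\Gamma_X(\pi)$. The tubes $\{\beta:\pi(\beta)\in U,\nu_j(\beta-\sigma(\pi(\beta)))<\varepsilon\}$ ($U$ open, $\sigma\in\Gamma_U(\pi)$, $\varepsilon>0$, $j\in J$) form a base of $\tau$. $(\Theta,\mathcal E)$-structure. Let $\mathfrak V=\langle\langle\mathfrak E,\tau\rangle,\pi,X,\mathfrak N\rangle$, $\mathcal E\subseteq\Gamma(\pi)$, $\Theta\subseteq\prod_xBounded(\mathfrak E_x)$, $\mathsf D(B,\mathcal E)=\mathcal E\cap\prod_xB(x)$, $\mathcal B_B^x=\{v(x):v\in\mathsf D(B,\mathcal E)\}$, $S_x=\{\mathcal B_B^x:B\in\Theta\}$, $Y$ a Hausdorff space. $\langle\mathfrak V,\mathfrak W;X,Y\rangle$ is a $(\Theta,\mathcal E)$-structure if $\mathsf D(B,\mathcal E)\ne\emptyset$ for all $B\in\Theta$, $\bigcup_{B}\mathcal B_B^x$ is total in $\mathfrak E_x$ for all $x$, and $\mathfrak W$ is a bundle of $\Omega$-spaces with stalks $\mathfrak M_x$ linear subspaces of $\mathcal C(Y,\mathcal L_{S_x}(\mathfrak E_x))$ and directed family of seminorms $\sup_{(K,j,B)\in O}q^x_{(K,j,B)}$, $O$ finite $\subset Comp(Y)\times J\times\Theta$, $q^x_{(K,j,B)}(f)=\sup_{t\in K}\sup_{v\in\mathsf D(B,\mathcal E)}\nu_j(f(t)v(x))$. *)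

theory Defs
  imports "HOL-Analysis.Analysis" "HOL-Algebra.Algebraic_Closure_Type"
begin

section \<open>Complex locally convex spaces with explicit carriers\<close>

text \<open>
  The stalks of a bundle are vector spaces that vary with the base point, so complex vector spaces
  are rendered as modules of HOL-Algebra over the field of complex numbers. The record fields
  \<open>mult\<close> and \<open>one\<close> inherited from rings play no role. Maps between carriers are
  extensional, i.e. fixed to \<open>undefined\<close> outside their domain.
\<close>

abbreviation cplx :: "complex ring"
  where "cplx \<equiv> ring_of_type_algebra"

abbreviation cvector_space :: "(complex, 'a) module \<Rightarrow> bool"
  where "cvector_space V \<equiv> Module.module cplx V"

definition linear_functional :: "(complex, 'a) module \<Rightarrow> ('a \<Rightarrow> complex) \<Rightarrow> bool"
  where "linear_functional V \<phi> \<longleftrightarrow>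
    (\<forall>u\<in>carrier V. \<forall>v\<in>carrier V. \<phi> (u \<oplus>\<^bsub>V\<^esub> v) = \<phi> u + \<phi> v) \<and>
    (\<forall>c. \<forall>v\<in>carrier V. \<phi> (c \<odot>\<^bsub>V\<^esub> v) = c * \<phi> v)"

definition linear_endo :: "(complex, 'a) module \<Rightarrow> ('a \<Rightarrow> 'a) \<Rightarrow> bool"
  where "linear_endo V f \<longleftrightarrow>
    (\<forall>v\<in>carrier V. f v \<in> carrier V) \<and>
    (\<forall>u\<in>carrier V. \<forall>v\<in>carrier V. f (u \<oplus>\<^bsub>V\<^esub> v) = f u \<oplus>\<^bsub>V\<^esub> f v) \<and>
    (\<forall>c. \<forall>v\<in>carrier V. f (c \<odot>\<^bsub>V\<^esub> v) = c \<odot>\<^bsub>V\<^esub> f v)"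

definition seminorm :: "(complex, 'a) module \<Rightarrow> ('a \<Rightarrow> real) \<Rightarrow> bool"
  where "seminorm V p \<longleftrightarrow>
    (\<forall>v\<in>carrier V. 0 \<le> p v) \<and>
    (\<forall>u\<in>carrier V. \<forall>v\<in>carrier V. p (u \<oplus>\<^bsub>V\<^esub> v) \<le> p u + p v) \<and>
    (\<forall>c. \<forall>v\<in>carrier V. p (c \<odot>\<^bsub>V\<^esub> v) = cmod c * p v)"

text \<open>The whole carrier is added to the subbase so that an empty family gives the indiscrete topology.\<close>

definition seminorm_topology :: "(complex, 'a) module \<Rightarrow> ('a \<Rightarrow> real) set \<Rightarrow> 'a topology"
  where "seminorm_topology V P = topology_generated_by
    (insert (carrier V)
      {{v \<in> carrier V. p (v \<ominus>\<^bsub>V\<^esub> u) < \<epsilon>} |p u \<epsilon>. p \<in> P \<and> u \<in> carrier V \<and> \<epsilon> > 0})"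

definition tvs_bounded :: "(complex, 'a) module \<Rightarrow> 'a topology \<Rightarrow> 'a set \<Rightarrow> bool"
  where "tvs_bounded V T A \<longleftrightarrow> A \<subseteq> carrier V \<and>
    (\<forall>U. openin T U \<and> \<zero>\<^bsub>V\<^esub> \<in> U \<longrightarrow>
      (\<exists>r>0. \<forall>c. cmod c \<ge> r \<longrightarrow> A \<subseteq> (\<lambda>v. c \<odot>\<^bsub>V\<^esub> v) ` U))"

definition linear_span :: "(complex, 'a) module \<Rightarrow> 'a set \<Rightarrow> 'a set"
  where "linear_span V A = \<Inter>{H. submodule H cplx V \<and> A \<subseteq> H}"

definition total_in :: "(complex, 'a) module \<Rightarrow> 'a topology \<Rightarrow> 'a set \<Rightarrow> bool"
  where "total_in V T A \<longleftrightarrow>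
    A \<subseteq> carrier V \<and> T closure_of (linear_span V A) = carrier V"

definition dual_space :: "(complex, 'a) module \<Rightarrow> 'a topology \<Rightarrow> (complex, 'a \<Rightarrow> complex) module"
  where "dual_space V T =
    \<lparr>carrier = {\<phi> \<in> extensional (carrier V).
        linear_functional V \<phi> \<and> continuous_map T euclidean \<phi>},
     monoid.mult = undefined, one = undefined,
     ring.zero = (\<lambda>v\<in>carrier V. 0),
     add = (\<lambda>\<phi> \<psi>. \<lambda>v\<in>carrier V. \<phi> v + \<psi> v),
     smult = (\<lambda>c \<phi>. \<lambda>v\<in>carrier V. c * \<phi> v)\<rparr>"

definition endo_space :: "(complex, 'a) module \<Rightarrow> 'a topology \<Rightarrow> (complex, 'a \<Rightarrow> 'a) module"
  where "endo_space V T =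
    \<lparr>carrier = {f \<in> extensional (carrier V). linear_endo V f \<and> continuous_map T T f},
     monoid.mult = compose (carrier V), one = (\<lambda>v\<in>carrier V. v),
     ring.zero = (\<lambda>v\<in>carrier V. \<zero>\<^bsub>V\<^esub>),
     add = (\<lambda>f g. \<lambda>v\<in>carrier V. f v \<oplus>\<^bsub>V\<^esub> g v),
     smult = (\<lambda>c f. \<lambda>v\<in>carrier V. c \<odot>\<^bsub>V\<^esub> f v)\<rparr>"

text \<open>
  Supremum in \<open>[0,\<infinity>[\<close> of a nonnegative function, so that the supremum over the
  empty set is \<open>0\<close>.
\<close>

definition sup0 :: "'a set \<Rightarrow> ('a \<Rightarrow> real) \<Rightarrow> real"
  where "sup0 A f = Sup (insert 0 (f ` A))"

text \<open>
  Topology of uniform convergence on the members of \<open>S\<close>, where \<open>P\<close> is a family of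
  seminorms generating \<open>T\<close>.
\<close>

definition endo_topology ::
  "(complex, 'a) module \<Rightarrow> 'a topology \<Rightarrow> ('a \<Rightarrow> real) set \<Rightarrow> 'a set set \<Rightarrow> ('a \<Rightarrow> 'a) topology"
  where "endo_topology V T P S =
    seminorm_topology (endo_space V T) {\<lambda>f. sup0 A (\<lambda>v. p (f v)) |A p. A \<in> S \<and> p \<in> P}"


section \<open>Reflexive Banach spaces\<close>

definition banach_norm :: "(complex, 'a) module \<Rightarrow> 'a topology \<Rightarrow> ('a \<Rightarrow> real) \<Rightarrow> bool"
  where "banach_norm V T n \<longleftrightarrow>
    cvector_space V \<and> seminorm V n \<and> (\<forall>v\<in>carrier V. n v = 0 \<longrightarrow> v = \<zero>\<^bsub>V\<^esub>) \<and>
    T = seminorm_topology V {n} \<and>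
    (\<forall>s :: nat \<Rightarrow> 'a. range s \<subseteq> carrier V \<and>
        (\<forall>\<epsilon>>0. \<exists>N. \<forall>i\<ge>N. \<forall>k\<ge>N. n (s i \<ominus>\<^bsub>V\<^esub> s k) < \<epsilon>) \<longrightarrow>
      (\<exists>l\<in>carrier V. (\<lambda>i. n (s i \<ominus>\<^bsub>V\<^esub> l)) \<longlonglongrightarrow> 0))"

definition dual_norm :: "(complex, 'a) module \<Rightarrow> ('a \<Rightarrow> real) \<Rightarrow> ('a \<Rightarrow> complex) \<Rightarrow> real"
  where "dual_norm V n \<phi> = (SUP v\<in>{v \<in> carrier V. n v \<le> 1}. cmod (\<phi> v))"

definition op_norm :: "(complex, 'a) module \<Rightarrow> ('a \<Rightarrow> real) \<Rightarrow> ('a \<Rightarrow> 'a) \<Rightarrow> real"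
  where "op_norm V n f = (SUP v\<in>{v \<in> carrier V. n v \<le> 1}. n (f v))"

definition reflexive_banach :: "(complex, 'a) module \<Rightarrow> 'a topology \<Rightarrow> ('a \<Rightarrow> real) \<Rightarrow> bool"
  where "reflexive_banach V T n \<longleftrightarrow> banach_norm V T n \<and>
    (\<forall>\<Phi>\<in>carrier (dual_space (dual_space V T) (seminorm_topology (dual_space V T) {dual_norm V n})).
      \<exists>v\<in>carrier V. \<forall>\<phi>\<in>carrier (dual_space V T). \<Phi> \<phi> = \<phi> v)"


section \<open>Integration\<close>

definition lower_semicontinuous :: "'y topology \<Rightarrow> ('y \<Rightarrow> ennreal) \<Rightarrow> bool"
  where "lower_semicontinuous Y g \<longleftrightarrow> (\<forall>c. openin Y {y \<in> topspace Y. c < g y})"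

text \<open>
  Bourbaki's upper integral. The library integral \<open>nn_integral\<close> of a non-measurable function
  is a lower integral, hence the infimum over lower semicontinuous majorants.
\<close>

definition upper_integral :: "'y topology \<Rightarrow> 'y measure \<Rightarrow> ('y \<Rightarrow> ennreal) \<Rightarrow> ennreal"
  where "upper_integral Y M f =
    Inf {(\<integral>\<^sup>+ y. g y \<partial>M) |g. lower_semicontinuous Y g \<and> (\<forall>y\<in>topspace Y. f y \<le> g y)}"

text \<open>
  Scalarly integrable maps whose weak integral lies in the space. For a \<open>\<sigma>\<close>-finite
  Radon measure, such as the ones below, essential integrability is integrability.
\<close>

definition scalarly_L1 ::
  "'y measure \<Rightarrow> (complex, 'a) module \<Rightarrow> 'a topology \<Rightarrow> ('y \<Rightarrow> 'a) set"
  where "scalarly_L1 M V T = {F \<in> space M \<rightarrow>\<^sub>E carrier V.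
    (\<forall>\<phi>\<in>carrier (dual_space V T). integrable M (\<lambda>y. \<phi> (F y))) \<and>
    (\<exists>w\<in>carrier V. \<forall>\<phi>\<in>carrier (dual_space V T). \<phi> w = (\<integral>y. \<phi> (F y) \<partial>M))}"

abbreviation Rplus :: "real topology"
  where "Rplus \<equiv> top_of_set {0..}"

definition exp_measure :: "real \<Rightarrow> real measure"
  where "exp_measure l = density (lebesgue_on {0..}) (\<lambda>s. ennreal (exp (- l * s)))"


section \<open>Bundles of Omega-spaces\<close>

record ('x, 'e, 'j) vbundle =
  total_space :: "'e topology"
  base_space :: "'x topology"
  proj :: "'e \<Rightarrow> 'x"
  stalk :: "'x \<Rightarrow> (complex, 'e) module"
  idx :: "'j set"
  nu :: "'j \<Rightarrow> 'e \<Rightarrow> real"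

definition stalk_topology :: "('x, 'e, 'j) vbundle \<Rightarrow> 'x \<Rightarrow> 'e topology"
  where "stalk_topology V x = subtopology (total_space V) (carrier (stalk V x))"

definition bounded_sections :: "('x, 'e, 'j) vbundle \<Rightarrow> 'x set \<Rightarrow> ('x \<Rightarrow> 'e) set"
  where "bounded_sections V U = {\<sigma> \<in> extensional U.
    continuous_map (subtopology (base_space V) U) (total_space V) \<sigma> \<and>
    (\<forall>x\<in>U. proj V (\<sigma> x) = x) \<and>
    (\<forall>j\<in>idx V. bdd_above ((\<lambda>x. nu V j (\<sigma> x)) ` U))}"

definition tubes :: "('x, 'e, 'j) vbundle \<Rightarrow> 'e set set"
  where "tubes V =
    {{b \<in> topspace (total_space V). proj V b \<in> U \<and>
        nu V j (b \<ominus>\<^bsub>stalk V (proj V b)\<^esub> \<sigma> (proj V b)) < \<epsilon>} |U \<sigma> \<epsilon> j.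
      openin (base_space V) U \<and> \<sigma> \<in> bounded_sections V U \<and> \<epsilon> > 0 \<and> j \<in> idx V}"

definition omega_bundle :: "('x, 'e, 'j) vbundle \<Rightarrow> bool"
  where "omega_bundle V \<longleftrightarrow>
    continuous_map (total_space V) (base_space V) (proj V) \<and>
    open_map (total_space V) (base_space V) (proj V) \<and>
    proj V ` topspace (total_space V) = topspace (base_space V) \<and>
    (\<forall>x\<in>topspace (base_space V). cvector_space (stalk V x) \<and>
      carrier (stalk V x) = {e \<in> topspace (total_space V). proj V e = x}) \<and>
    continuous_map
      (subtopology (prod_topology (total_space V) (total_space V)) {(a, b). proj V a = proj V b})
      (total_space V) (\<lambda>(a, b). a \<oplus>\<^bsub>stalk V (proj V a)\<^esub> b) \<and>
    continuous_map (prod_topology euclidean (total_space V)) (total_space V)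
      (\<lambda>(c, a). c \<odot>\<^bsub>stalk V (proj V a)\<^esub> a) \<and>
    idx V \<noteq> {} \<and>
    (\<forall>x\<in>topspace (base_space V).
      (\<forall>j\<in>idx V. seminorm (stalk V x) (nu V j)) \<and>
      (\<forall>i\<in>idx V. \<forall>j\<in>idx V. \<exists>k\<in>idx V. \<forall>e\<in>carrier (stalk V x).
        nu V i e \<le> nu V k e \<and> nu V j e \<le> nu V k e) \<and>
      stalk_topology V x = seminorm_topology (stalk V x) (nu V ` idx V) \<and>
      Hausdorff_space (stalk_topology V x)) \<and>
    openin (total_space V) = arbitrary union_of (\<lambda>T. T \<in> tubes V)"


section \<open>Structures\<close>

definition selections :: "('x, 'e, 'j) vbundle \<Rightarrow> ('x \<Rightarrow> 'e) set \<Rightarrow> ('x \<Rightarrow> 'e set) \<Rightarrow> ('x \<Rightarrow> 'e) set"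
  where "selections V \<E> B = \<E> \<inter> (\<Pi>\<^sub>E x\<in>topspace (base_space V). B x)"

definition S_family ::
  "('x, 'e, 'j) vbundle \<Rightarrow> ('x \<Rightarrow> 'e set) set \<Rightarrow> ('x \<Rightarrow> 'e) set \<Rightarrow> 'x \<Rightarrow> 'e set set"
  where "S_family V \<Theta> \<E> x = (\<lambda>B. (\<lambda>v. v x) ` selections V \<E> B) ` \<Theta>"

abbreviation LE :: "('x, 'e, 'j) vbundle \<Rightarrow> 'x \<Rightarrow> (complex, 'e \<Rightarrow> 'e) module"
  where "LE V x \<equiv> endo_space (stalk V x) (stalk_topology V x)"

definition LS_topology ::
  "('x, 'e, 'j) vbundle \<Rightarrow> ('x \<Rightarrow> 'e set) set \<Rightarrow> ('x \<Rightarrow> 'e) set \<Rightarrow> 'x \<Rightarrow> ('e \<Rightarrow> 'e) topology"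
  where "LS_topology V \<Theta> \<E> x =
    endo_topology (stalk V x) (stalk_topology V x) (nu V ` idx V) (S_family V \<Theta> \<E> x)"

definition cont_maps ::
  "('x, 'e, 'j) vbundle \<Rightarrow> ('x \<Rightarrow> 'e set) set \<Rightarrow> ('x \<Rightarrow> 'e) set \<Rightarrow> 'y topology \<Rightarrow> 'x \<Rightarrow>
    (complex, 'y \<Rightarrow> 'e \<Rightarrow> 'e) module"
  where "cont_maps V \<Theta> \<E> Y x =
    \<lparr>carrier = {F \<in> extensional (topspace Y). continuous_map Y (LS_topology V \<Theta> \<E> x) F},
     monoid.mult = undefined, one = undefined,
     ring.zero = (\<lambda>t\<in>topspace Y. \<zero>\<^bsub>LE V x\<^esub>),
     add = (\<lambda>F G. \<lambda>t\<in>topspace Y. F t \<oplus>\<^bsub>LE V x\<^esub> G t),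
     smult = (\<lambda>c F. \<lambda>t\<in>topspace Y. c \<odot>\<^bsub>LE V x\<^esub> F t)\<rparr>"

definition q_seminorm ::
  "('x, 'e, 'j) vbundle \<Rightarrow> ('x \<Rightarrow> 'e) set \<Rightarrow> 'x \<Rightarrow> 'y set \<times> 'j \<times> ('x \<Rightarrow> 'e set) \<Rightarrow>
    ('y \<Rightarrow> 'e \<Rightarrow> 'e) \<Rightarrow> real"
  where "q_seminorm V \<E> x = (\<lambda>(K, j, B) F.
    sup0 K (\<lambda>t. sup0 (selections V \<E> B) (\<lambda>v. nu V j (F t (v x)))))"

text \<open>
  Elements of the total space of \<open>W\<close> are pairs \<open>(x, F)\<close>, which keeps the stalks
  disjoint; \<open>stalk_maps W x\<close> is the stalk over \<open>x\<close> as a space of maps.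
\<close>

definition stalk_maps :: "('x, 'x \<times> 'f, 'k) vbundle \<Rightarrow> 'x \<Rightarrow> 'f set"
  where "stalk_maps W x = snd ` carrier (stalk W x)"

definition Theta_structure ::
  "('x, 'e, 'j) vbundle \<Rightarrow>
   ('x, 'x \<times> ('y \<Rightarrow> 'e \<Rightarrow> 'e), ('y set \<times> 'j \<times> ('x \<Rightarrow> 'e set)) set) vbundle \<Rightarrow>
   'y topology \<Rightarrow> ('x \<Rightarrow> 'e set) set \<Rightarrow> ('x \<Rightarrow> 'e) set \<Rightarrow> bool"
  where "Theta_structure V W Y \<Theta> \<E> \<longleftrightarrow>
    omega_bundle V \<and> omega_bundle W \<and> base_space W = base_space V \<and> Hausdorff_space Y \<and>
    \<E> \<subseteq> bounded_sections V (topspace (base_space V)) \<and>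
    \<Theta> \<subseteq> (\<Pi>\<^sub>E x\<in>topspace (base_space V). {A. tvs_bounded (stalk V x) (stalk_topology V x) A}) \<and>
    (\<forall>B\<in>\<Theta>. selections V \<E> B \<noteq> {}) \<and>
    (\<forall>x\<in>topspace (base_space V).
      total_in (stalk V x) (stalk_topology V x) (\<Union>(S_family V \<Theta> \<E> x))) \<and>
    (\<forall>m\<in>topspace (total_space W). proj W m = fst m) \<and>
    idx W = {Q. finite Q \<and> Q \<subseteq> {K. compactin Y K} \<times> idx V \<times> \<Theta>} \<and>
    (\<forall>x\<in>topspace (base_space V).
      submodule (stalk_maps W x) cplx (cont_maps V \<Theta> \<E> Y x) \<and>
      (\<forall>F\<in>stalk_maps W x. \<forall>G\<in>stalk_maps W x.
        (x, F) \<oplus>\<^bsub>stalk W x\<^esub> (x, G) = (x, F \<oplus>\<^bsub>cont_maps V \<Theta> \<E> Y x\<^esub> G)) \<and>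
      (\<forall>c. \<forall>F\<in>stalk_maps W x.
        c \<odot>\<^bsub>stalk W x\<^esub> (x, F) = (x, c \<odot>\<^bsub>cont_maps V \<Theta> \<E> Y x\<^esub> F)) \<and>
      (\<forall>Q\<in>idx W. \<forall>F\<in>stalk_maps W x.
        nu W Q (x, F) = Max (insert 0 ((\<lambda>i. q_seminorm V \<E> x i F) ` Q))))"

definition contraction_semigroups ::
  "('x, 'e, 'j) vbundle \<Rightarrow> ('x \<Rightarrow> 'e set) set \<Rightarrow> ('x \<Rightarrow> 'e) set \<Rightarrow> ('e \<Rightarrow> real) \<Rightarrow> 'x \<Rightarrow>
    (real \<Rightarrow> 'e \<Rightarrow> 'e) set"
  where "contraction_semigroups V \<Theta> \<E> n x = {U \<in> carrier (cont_maps V \<Theta> \<E> Rplus x).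
    (\<forall>s\<ge>0. \<forall>t\<ge>0. U (s + t) = U s \<otimes>\<^bsub>LE V x\<^esub> U t) \<and>
    (\<forall>s\<ge>0. op_norm (stalk V x) n (U s) \<le> 1)}"

end

theory Submission
  imports Defs
begin

text \<open>
  A continuous linear functional \<open>\<phi>\<close> on \<open>L\<^sub>S(E)\<close>, where the members of \<open>S\<close> are finite, satisfies
  \<open>|\<phi> f| \<le> C \<Sum>v\<in>A. \<parallel>f v\<parallel>\<close> for some finite \<open>A \<subseteq> \<Union>S\<close>. For \<open>v \<in> \<Union>S\<close>, and hence for \<open>v\<close> in the span of
  \<open>\<Union>S\<close>, the map \<open>s \<mapsto> F s v\<close> is norm continuous and dominated by \<open>\<parallel>F s\<parallel> \<parallel>v\<parallel>\<close>, so the Riemann sums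
  \<open>R v\<close> of \<open>s \<mapsto> e\<^sup>-\<^sup>\<lambda>\<^sup>s F s v\<close> converge in norm to some \<open>w v\<close> with \<open>\<parallel>w v\<parallel> \<le> J \<parallel>v\<parallel>\<close>, where \<open>J\<close> bounds the
  upper integral of \<open>e\<^sup>-\<^sup>\<lambda>\<^sup>s \<parallel>F s\<parallel>\<close>. Since the span is dense, \<open>w\<close> extends to a continuous endomorphism
  of \<open>E\<close>. The bound on \<open>\<phi>\<close> gives \<open>\<phi> R \<longlonglongrightarrow> \<phi> w\<close>, while \<open>\<phi> R\<close>, being a Riemann sum of
  \<open>e\<^sup>-\<^sup>\<lambda>\<^sup>s \<phi> (F s)\<close>, converges to the integral of \<open>\<phi> \<circ> F\<close>; hence \<open>w\<close> is the weak integral of \<open>F\<close>.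
\<close>

section \<open>Riemann sums on the half-line\<close>

text \<open>The operator norm \<open>op_norm V n (F s)\<close> comes without any measurability in
  \<open>s\<close>, so it is never integrated itself. What is integrated is
  \<open>n (F s v)\<close>, for vectors \<open>v\<close> that make it continuous, under a majorant
  of finite integral supplied by the upper integral and independent of \<open>v\<close>. The
  approximation takes place among operators and not among vectors one at a time: each Riemann sum is
  itself a continuous endomorphism, to which evaluation at \<open>v\<close> and the functional
  \<phi> can both be applied, and this common net ties the vector integrals to the scalar one. Away
  from the dense subspace the value of \<open>w\<close> is fixed by density alone; this suffices
  because the bound on \<phi> only sees vectors of the subspace. The stalk is a carrier inside an
  arbitrary type, so limits in it are expressed through real numbers
  \<open>n (R a \<ominus> l)\<close>, and compactness and integration arguments are moved to real
  functions such as \<open>n (G s)\<close> and \<open>n (G s \<ominus> G t)\<close>.\<close>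

text \<open>
  The iterated limit over pairs \<open>(N, k)\<close>, first \<open>k \<longlonglongrightarrow> \<infinity>\<close> (mesh \<open>2\<^sup>-\<^sup>k\<close> on \<open>[0, N]\<close>) and then
  \<open>N \<longlonglongrightarrow> \<infinity>\<close>. The joint limit would fail, because no mesh is fine enough for all \<open>N\<close> at once.
\<close>

definition riemann_filter :: "(nat \<times> nat) filter"
  where "riemann_filter =
    Abs_filter (\<lambda>P. \<forall>\<^sub>F N in sequentially. \<forall>\<^sub>F k in sequentially. P (N, k))"

lemma eventually_riemann_filter:
  "eventually P riemann_filter \<longleftrightarrow> (\<forall>\<^sub>F N in sequentially. \<forall>\<^sub>F k in sequentially. P (N, k))"
  unfolding riemann_filter_def
proof (rule eventually_Abs_filter, standard, goal_cases)
  case (2 P Q)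
  then show ?case
    by eventually_elim (rule eventually_conj)
next
  case (3 P Q)
  from 3(2) show ?case
    by (rule eventually_mono) (auto elim: eventually_mono simp: 3(1))
qed auto

lemma riemann_filter_neq_bot: "riemann_filter \<noteq> bot"
  by (simp add: trivial_limit_def eventually_riemann_filter)

text \<open>Left endpoints of dyadic cells: with dyadic meshes a sum with larger \<open>k\<close>
  always refines one with smaller \<open>k\<close>, which \<open>curve_sum_refine\<close>
  exploits.\<close>

definition riemann_sum :: "(real \<Rightarrow> 'a::real_vector) \<Rightarrow> nat \<times> nat \<Rightarrow> 'a"
  where "riemann_sum h = (\<lambda>(N, k). \<Sum>i<N * 2 ^ k. h (real i / 2 ^ k) /\<^sub>R 2 ^ k)"

lemma integral_split_nodes:
  fixes h :: "real \<Rightarrow> 'a::banach"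
  assumes "h integrable_on {0..real K / m}" and "m > 0"
  shows "integral {0..real K / m} h = (\<Sum>i<K. integral {real i / m..real (Suc i) / m} h)"
  using assms(1)
proof (induction K)
  case (Suc K)
  have le: "0 \<le> real K / m" "real K / m \<le> real (Suc K) / m"
    using assms(2) by (auto simp: divide_right_mono)
  have "h integrable_on {0..real K / m}"
    by (rule integrable_on_subinterval[OF Suc.prems]) (use le in auto)
  then show ?case
    using Suc.IH Henstock_Kurzweil_Integration.integral_combine[OF le Suc.prems] by simp
qed simp

lemma riemann_sum_tendsto_integral:
  fixes h :: "real \<Rightarrow> 'a::banach"
  assumes "continuous_on {0..real N} h"
  shows "(\<lambda>k. riemann_sum h (N, k)) \<longlonglongrightarrow> integral {0..real N} h"
proof (rule LIMSEQ_I)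
  fix r :: real assume "r > 0"
  \<comment> \<open>Each of the \<open>N * m\<close> cells contributes at most \<open>e / m\<close>,
    in total \<open>N * e\<close>. The \<open>+ 1\<close> keeps this strictly below \<open>r\<close>
    and covers \<open>N = 0\<close>.\<close>
  define e where "e = r / (real N + 1)"
  have "e > 0" using \<open>r > 0\<close> by (simp add: e_def)
  have "uniformly_continuous_on {0..real N} h"
    by (rule compact_uniformly_continuous[OF assms]) simp
  then obtain d where "d > 0"
    and d: "\<And>s t. s \<in> {0..real N} \<Longrightarrow> t \<in> {0..real N} \<Longrightarrow> dist t s < d \<Longrightarrow> dist (h t) (h s) < e"
    unfolding uniformly_continuous_on_def using \<open>e > 0\<close> by metis
  obtain k0 where k0: "(1/2) ^ k0 < d"
    using real_arch_pow_inv[OF \<open>d > 0\<close>, of "1/2"] by auto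
  show "\<exists>no. \<forall>k\<ge>no. norm (riemann_sum h (N, k) - integral {0..real N} h) < r"
  proof (intro exI[of _ k0] allI impI)
    fix k assume "k \<ge> k0"
    define m :: real where "m = 2 ^ k"
    define K where "K = N * 2 ^ k"
    have "m > 0" by (simp add: m_def)
    have KN: "real K / m = real N" by (simp add: K_def m_def)
    have "(1/2) ^ k \<le> (1/2 :: real) ^ k0"
      by (rule power_decreasing[OF \<open>k \<ge> k0\<close>]) auto
    then have m: "1 / m < d"
      using k0 by (simp add: m_def power_one_over)
    have int: "h integrable_on {0..real K / m}"
      unfolding KN by (rule integrable_continuous_real[OF assms])
    have each: "norm (h (real i / m) /\<^sub>R m - integral {real i / m..real (Suc i) / m} h) \<le> e / m"
      if "i < K" for i
    proof -
      have le: "real i / m \<le> real (Suc i) / m" "real (Suc i) / m - real i / m = 1 / m"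
        using \<open>m > 0\<close> by (auto simp: divide_right_mono field_simps)
      have up: "real (Suc i) / m \<le> real N"
        unfolding KN[symmetric] using that \<open>m > 0\<close> by (intro divide_right_mono) auto
      have sub: "{real i / m..real (Suc i) / m} \<subseteq> {0..real N}"
        using up \<open>m > 0\<close> by auto
      have 1: "((\<lambda>s. h (real i / m)) has_integral (1 / m) *\<^sub>R h (real i / m)) {real i / m..real (Suc i) / m}"
        using has_integral_const_real[of "h (real i / m)" "real i / m" "real (Suc i) / m"] le by simp
      have 2: "(h has_integral integral {real i / m..real (Suc i) / m} h) {real i / m..real (Suc i) / m}"
        by (rule integrable_integral, rule integrable_continuous_real)
           (rule continuous_on_subset[OF assms sub])
      have 3: "norm (h (real i / m) - h s) \<le> e" if s: "s \<in> {real i / m..real (Suc i) / m}" for s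
      proof -
        have "dist (real i / m) s < d"
          using s le m by (auto simp: dist_real_def)
        then show ?thesis
          using d[of s "real i / m"] s sub le(1) by (force simp: dist_norm)
      qed
      have "norm ((1 / m) *\<^sub>R h (real i / m) - integral {real i / m..real (Suc i) / m} h)
          \<le> e * measure lborel (cbox (real i / m) (real (Suc i) / m))"
        using has_integral_diff[OF 1 2] 3 \<open>e > 0\<close>
        by (intro has_integral_bound[where f = "\<lambda>s. h (real i / m) - h s"]) auto
      then show ?thesis
        using le by (simp add: divide_inverse)
    qed
    have "riemann_sum h (N, k) - integral {0..real N} h
        = (\<Sum>i<K. h (real i / m) /\<^sub>R m - integral {real i / m..real (Suc i) / m} h)"
      using integral_split_nodes[OF int \<open>m > 0\<close>]
      by (simp add: riemann_sum_def K_def[symmetric] m_def[symmetric] KN sum_subtractf)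
    also have "norm \<dots> \<le> (\<Sum>i<K. e / m)"
      by (rule sum_norm_le) (use each in auto)
    also have "\<dots> = e * (real K / m)" by simp
    also have "\<dots> < r"
      unfolding KN e_def using \<open>r > 0\<close> by (simp add: field_simps)
    finally show "norm (riemann_sum h (N, k) - integral {0..real N} h) < r" .
  qed
qed

text \<open>Dominated convergence for the truncations to \<open>[0, N]\<close>, with
  \<open>norm (h s)\<close> as dominating function. It leads from the Lebesgue integral on the
  half-line to gauge integrals over compact intervals, where Riemann sums converge.\<close>

lemma integral_halfline_limit:
  fixes h :: "real \<Rightarrow> 'a::euclidean_space"
  assumes "integrable (lebesgue_on {0..}) h"
  shows "(\<lambda>N. integral {0..real N} h) \<longlonglongrightarrow> (\<integral>s. h s \<partial>lebesgue_on {0..})"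
proof -
  have [measurable]: "h \<in> borel_measurable (lebesgue_on {0..})"
    using assms by auto
  have [measurable]: "(\<lambda>s. indicat_real {0..real N} s) \<in> borel_measurable (lebesgue_on {0..})" for N
    by (intro measurable_restrict_space1 borel_measurable_indicator) auto
  have int: "integrable (lebesgue_on {0..}) (\<lambda>s. indicator {0..real N} s *\<^sub>R h s)" for N
    by (rule Bochner_Integration.integrable_bound[OF assms]) (measurable, auto simp: indicator_def)
  have lim: "(\<lambda>N. \<integral>s. indicator {0..real N} s *\<^sub>R h s \<partial>lebesgue_on {0..})
      \<longlonglongrightarrow> (\<integral>s. h s \<partial>lebesgue_on {0..})"
  proof (rule integral_dominated_convergence[where w = "\<lambda>s. norm (h s)"])
    show "AE s in lebesgue_on {0..}. (\<lambda>N. indicator {0..real N} s *\<^sub>R h s) \<longlonglongrightarrow> h s"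
    proof (rule AE_I2)
      fix s :: real assume "s \<in> space (lebesgue_on {0..})"
      then have "s \<ge> 0" by simp
      have "\<forall>\<^sub>F N in sequentially. indicator {0..real N} s *\<^sub>R h s = h s"
        using eventually_ge_at_top[of "nat \<lceil>s\<rceil>"]
        by eventually_elim (use \<open>s \<ge> 0\<close> in \<open>auto simp: indicator_def nat_le_iff ceiling_le_iff\<close>)
      then show "(\<lambda>N. indicator {0..real N} s *\<^sub>R h s) \<longlonglongrightarrow> h s"
        by (rule tendsto_eventually)
    qed
    show "AE s in lebesgue_on {0..}. norm (indicator {0..real N} s *\<^sub>R h s) \<le> norm (h s)" for N
      by (rule AE_I2) (auto simp: indicator_def)
  qed (use assms in auto)
  have "(\<integral>s. indicator {0..real N} s *\<^sub>R h s \<partial>lebesgue_on {0..}) = integral {0..real N} h" for N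
  proof -
    have "(\<integral>s. indicator {0..real N} s *\<^sub>R h s \<partial>lebesgue_on {0..})
        = integral {0..} (\<lambda>s. indicator {0..real N} s *\<^sub>R h s)"
      by (rule lebesgue_integral_eq_integral[OF int]) auto
    also have "\<dots> = integral {0..} (\<lambda>s. if s \<in> {0..real N} then h s else 0)"
      by (rule integral_cong) (auto simp: indicator_def)
    also have "\<dots> = integral {0..real N} h"
    proof -
      have "{0..real N} \<inter> {0..} = {0..real N}" by auto
      then show ?thesis
        by (simp only: Henstock_Kurzweil_Integration.integral_restrict_Int)
    qed
    finally show ?thesis .
  qed
  with lim show ?thesis by simp
qed

lemma riemann_sum_tendsto:
  fixes h :: "real \<Rightarrow> 'a::euclidean_space"
  assumes "continuous_on {0..} h" and "integrable (lebesgue_on {0..}) h"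
  shows "(riemann_sum h \<longlongrightarrow> (\<integral>s. h s \<partial>lebesgue_on {0..})) riemann_filter"
proof (rule tendstoI, unfold eventually_riemann_filter)
  fix e :: real assume "e > 0"
  have "\<forall>\<^sub>F N in sequentially. dist (integral {0..real N} h) (\<integral>s. h s \<partial>lebesgue_on {0..}) < e / 2"
    using integral_halfline_limit[OF assms(2)] \<open>e > 0\<close> by (intro tendstoD) auto
  then show "\<forall>\<^sub>F N in sequentially. \<forall>\<^sub>F k in sequentially.
      dist (riemann_sum h (N, k)) (\<integral>s. h s \<partial>lebesgue_on {0..}) < e"
  proof eventually_elim
    case (elim N)
    have "continuous_on {0..real N} h"
      by (rule continuous_on_subset[OF assms(1)]) auto
    then have "\<forall>\<^sub>F k in sequentially. dist (riemann_sum h (N, k)) (integral {0..real N} h) < e / 2"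
      using \<open>e > 0\<close> by (intro tendstoD[OF riemann_sum_tendsto_integral]) auto
    then show ?case
      by eventually_elim (use elim in \<open>metis dist_triangle_half_l dist_commute\<close>)
  qed
qed

text \<open>Here \<open>m\<close> stands for the weighted operator norm and \<open>g\<close> for a
  majorant taken from the upper integral. Only the continuous \<open>h\<close> has to be measurable,
  since \<open>nn_integral_mono\<close> compares arbitrary functions.\<close>

lemma integrable_majorized:
  fixes h m :: "real \<Rightarrow> real"
  assumes cont: "continuous_on {0..} h" and "K \<ge> 0"
    and h: "\<And>s. s \<ge> 0 \<Longrightarrow> 0 \<le> h s" "\<And>s. s \<ge> 0 \<Longrightarrow> h s \<le> K * m s"
    and g: "\<And>s. s \<ge> 0 \<Longrightarrow> ennreal (m s) \<le> g s" "(\<integral>\<^sup>+ s. g s \<partial>lebesgue_on {0..}) < \<infinity>"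
  shows "integrable (lebesgue_on {0..}) h"
    and "(\<integral>s. h s \<partial>lebesgue_on {0..}) \<le> K * enn2real (\<integral>\<^sup>+ s. g s \<partial>lebesgue_on {0..})"
proof -
  let ?M = "lebesgue_on {0..} :: real measure"
  have meas: "h \<in> borel_measurable ?M"
    by (rule continuous_imp_measurable_on_sets_lebesgue[OF cont]) auto
  have "integrable ?M h \<and> (\<integral>s. h s \<partial>?M) \<le> K * enn2real (\<integral>\<^sup>+ s. g s \<partial>?M)"
  \<comment> \<open>The comparison is between \<open>h / K\<close> and \<open>g\<close>, so that
    \<open>g\<close> need not be rescaled; for \<open>K = 0\<close> the function \<open>h\<close>
    vanishes on the half-line.\<close>
  proof (cases "K = 0")
    case True
    have zero: "h s = 0" if "s \<in> space ?M" for s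
      using h[of s] that True by simp
    have "integrable ?M h \<longleftrightarrow> integrable ?M (\<lambda>s. 0 :: real)"
      by (rule Bochner_Integration.integrable_cong) (use zero in auto)
    moreover have "(\<integral>s. h s \<partial>?M) = (\<integral>s. 0 \<partial>?M)"
      by (rule Bochner_Integration.integral_cong) (use zero in auto)
    ultimately show ?thesis using True by simp
  next
    case False
    then have "K > 0" using assms(2) by simp
    let ?h = "\<lambda>s. h s / K"
    have measK: "?h \<in> borel_measurable ?M" using meas by measurable
    have nonneg: "0 \<le> ?h s" if "s \<in> space ?M" for s
      using h(1)[of s] that \<open>K > 0\<close> by simp
    have le: "(\<integral>\<^sup>+ s. ennreal (?h s) \<partial>?M) \<le> (\<integral>\<^sup>+ s. g s \<partial>?M)"
    proof (rule nn_integral_mono)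
      fix s assume "s \<in> space ?M"
      then have "s \<ge> 0" by simp
      then have "?h s \<le> m s" using h(2)[of s] \<open>K > 0\<close> by (simp add: divide_le_eq mult.commute)
      then show "ennreal (?h s) \<le> g s"
        using g(1)[OF \<open>s \<ge> 0\<close>] ennreal_leI order_trans by blast
    qed
    have int: "integrable ?M ?h"
    proof (rule integrableI_bounded[OF measK])
      have "(\<integral>\<^sup>+ s. ennreal (norm (?h s)) \<partial>?M) = (\<integral>\<^sup>+ s. ennreal (?h s) \<partial>?M)"
        by (rule nn_integral_cong) (simp only: real_norm_def abs_of_nonneg[OF nonneg])
      also have "\<dots> < \<infinity>" by (rule le_less_trans[OF le g(2)])
      finally show "(\<integral>\<^sup>+ s. ennreal (norm (?h s)) \<partial>?M) < \<infinity>" .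
    qed
    have "(\<integral>s. ?h s \<partial>?M) = enn2real (\<integral>\<^sup>+ s. ennreal (?h s) \<partial>?M)"
      by (rule integral_eq_nn_integral[OF measK AE_I2[OF nonneg]])
    also have "\<dots> \<le> enn2real (\<integral>\<^sup>+ s. g s \<partial>?M)"
      using le g(2) by (intro enn2real_mono) (simp_all add: top.not_eq_extremum)
    finally have "(\<integral>s. h s \<partial>?M) / K \<le> enn2real (\<integral>\<^sup>+ s. g s \<partial>?M)" by simp
    then have "(\<integral>s. h s \<partial>?M) \<le> K * enn2real (\<integral>\<^sup>+ s. g s \<partial>?M)"
      using \<open>K > 0\<close> by (simp add: divide_le_eq mult.commute)
    moreover have "integrable ?M h"
      using integrable_mult_right[OF int, of K] \<open>K > 0\<close> by simp
    ultimately show ?thesis by blast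
  qed
  then show "integrable ?M h" "(\<integral>s. h s \<partial>?M) \<le> K * enn2real (\<integral>\<^sup>+ s. g s \<partial>?M)" by auto
qed


section \<open>Banach spaces with explicit carriers\<close>

lemma cplx_simps [simp]:
  "carrier cplx = UNIV" "a \<otimes>\<^bsub>cplx\<^esub> b = a * b" "a \<oplus>\<^bsub>cplx\<^esub> b = a + b"
  "\<one>\<^bsub>cplx\<^esub> = 1" "\<zero>\<^bsub>cplx\<^esub> = 0"
  by (simp_all add: ring_of_type_algebra_def)

text \<open>The conditions of \<open>banach_norm\<close> on the norm alone. The topology enters
  later as \<open>norm_topology\<close>, after the sums and limits that are pure norm
  estimates.\<close>

locale banach_module = Module.module cplx V for V :: "(complex, 'a) module" (structure) +
  fixes n :: "'a \<Rightarrow> real"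
  assumes seminorm: "seminorm V n"
    and norm_eq_zero: "v \<in> carrier V \<Longrightarrow> n v = 0 \<Longrightarrow> v = \<zero>"
    and complete: "range s \<subseteq> carrier V \<Longrightarrow> (\<And>e. e > 0 \<Longrightarrow> \<exists>N. \<forall>i\<ge>N. \<forall>k\<ge>N. n (s i \<ominus> s k) < e)
      \<Longrightarrow> \<exists>l\<in>carrier V. (\<lambda>i::nat. n (s i \<ominus> l)) \<longlonglongrightarrow> 0"
begin

lemma norm_nonneg [simp]: "v \<in> carrier V \<Longrightarrow> 0 \<le> n v"
  and norm_triangle: "u \<in> carrier V \<Longrightarrow> v \<in> carrier V \<Longrightarrow> n (u \<oplus> v) \<le> n u + n v"
  and norm_smult [simp]: "v \<in> carrier V \<Longrightarrow> n (c \<odot> v) = cmod c * n v"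
  using seminorm by (auto simp: seminorm_def)

lemma smult_carrier [simp, intro]: "v \<in> carrier V \<Longrightarrow> c \<odot> v \<in> carrier V"
  using smult_closed[of c v] by simp

lemma smult_add_left: "v \<in> carrier V \<Longrightarrow> (a + b) \<odot> v = a \<odot> v \<oplus> b \<odot> v"
  using smult_l_distr[of a b v] by simp

lemma smult_add_right:
  "u \<in> carrier V \<Longrightarrow> v \<in> carrier V \<Longrightarrow> a \<odot> (u \<oplus> v) = a \<odot> u \<oplus> a \<odot> v"
  using smult_r_distr[of a u v] by simp

lemma smult_smult: "v \<in> carrier V \<Longrightarrow> a \<odot> (b \<odot> v) = (a * b) \<odot> v"
  using smult_assoc1[of a b v] by simp

lemma smult_0 [simp]: "v \<in> carrier V \<Longrightarrow> 0 \<odot> v = \<zero>"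
  using smult_l_null[of v] by simp

lemma smult_1 [simp]: "v \<in> carrier V \<Longrightarrow> 1 \<odot> v = v"
  using smult_one[of v] by simp

lemma uminus_eq_smult:
  assumes "v \<in> carrier V" shows "\<ominus> v = (- 1) \<odot> v"
proof (rule minus_equality)
  show "(- 1) \<odot> v \<oplus> v = \<zero>"
    using smult_add_left[OF assms, of "- 1" 1] assms by simp
qed (use assms in auto)

lemma minus_eq_smult: "u \<in> carrier V \<Longrightarrow> v \<in> carrier V \<Longrightarrow> u \<ominus> v = u \<oplus> (- 1) \<odot> v"
  by (simp add: minus_eq uminus_eq_smult)

lemma diff_carrier [simp, intro]: "u \<in> carrier V \<Longrightarrow> v \<in> carrier V \<Longrightarrow> u \<ominus> v \<in> carrier V"
  by (rule minus_closed)

lemma norm_zero [simp]: "n \<zero> = 0"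
  using norm_smult[of \<zero> 0] by simp

lemma norm_diff_self [simp]: "v \<in> carrier V \<Longrightarrow> n (v \<ominus> v) = 0"
  by (simp add: minus_eq r_neg)

lemma norm_diff_zero [simp]: "v \<in> carrier V \<Longrightarrow> n (v \<ominus> \<zero>) = n v"
  by (simp add: minus_eq_smult)

lemma norm_diff_commute:
  assumes "u \<in> carrier V" "v \<in> carrier V" shows "n (u \<ominus> v) = n (v \<ominus> u)"
proof -
  have "v \<ominus> u = (- 1) \<odot> (u \<ominus> v)"
    using assms by (simp add: minus_eq_smult smult_add_right smult_smult a_comm)
  then show ?thesis using assms by simp
qed

text \<open>Stated for any seminorm because the bundle seminorms on a stalk need it as well as the
  Banach norm.\<close>

lemma seminorm_diff_triangle:
  assumes "seminorm V p" "u \<in> carrier V" "v \<in> carrier V" "w \<in> carrier V"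
  shows "p (u \<ominus> w) \<le> p (u \<ominus> v) + p (v \<ominus> w)"
proof -
  have "u \<ominus> w = (u \<ominus> v) \<oplus> (v \<ominus> w)"
    using assms by (simp add: minus_eq a_ac l_neg r_neg1 r_neg2)
  then show ?thesis
    using assms by (simp add: seminorm_def)
qed

lemmas norm_diff_triangle = seminorm_diff_triangle[OF seminorm]

lemma norm_add_diff:
  assumes "a \<in> carrier V" "b \<in> carrier V" "c \<in> carrier V" "d \<in> carrier V"
  shows "n ((a \<oplus> b) \<ominus> (c \<oplus> d)) \<le> n (a \<ominus> c) + n (b \<ominus> d)"
proof -
  have "(a \<oplus> b) \<ominus> (c \<oplus> d) = (a \<ominus> c) \<oplus> (b \<ominus> d)"
    using assms by (simp add: minus_eq a_ac minus_add)
  then show ?thesis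
    using norm_triangle[of "a \<ominus> c" "b \<ominus> d"] assms by simp
qed

lemma norm_smult_diff:
  assumes "u \<in> carrier V" "v \<in> carrier V"
  shows "n (c \<odot> u \<ominus> c \<odot> v) = cmod c * n (u \<ominus> v)"
proof -
  have "c \<odot> u \<ominus> c \<odot> v = c \<odot> (u \<ominus> v)"
    using assms by (simp add: minus_eq_smult smult_add_right smult_smult mult.commute)
  then show ?thesis using assms by simp
qed

lemma norm_le_diff: "u \<in> carrier V \<Longrightarrow> v \<in> carrier V \<Longrightarrow> n u \<le> n (u \<ominus> v) + n v"
  using norm_diff_triangle[of u v \<zero>] by simp

lemma abs_norm_diff_le:
  assumes "u \<in> carrier V" "v \<in> carrier V" shows "\<bar>n u - n v\<bar> \<le> n (u \<ominus> v)"
  using norm_le_diff[OF assms] norm_le_diff[OF assms(2,1)] norm_diff_commute[OF assms] by linarith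

lemma eq_if_norm_diff_le:
  assumes "u \<in> carrier V" "v \<in> carrier V" "n (u \<ominus> v) \<le> 0" shows "u = v"
proof -
  have "n (u \<ominus> v) = 0" using assms by (intro antisym) auto
  then have "u \<ominus> v = \<zero>" using assms by (intro norm_eq_zero) auto
  moreover have "u = (u \<ominus> v) \<oplus> v" using assms by (simp add: minus_eq a_assoc l_neg)
  ultimately show ?thesis using assms by simp
qed

lemma finsum_lessThan_Suc:
  "f \<in> {..<Suc k} \<rightarrow> carrier V \<Longrightarrow> finsum V f {..<Suc k} = finsum V f {..<k} \<oplus> f k"
  unfolding lessThan_Suc by (subst finsum_insert) (auto simp: Pi_def a_comm)

lemma finsum_lessThan_add:
  assumes "\<And>i. f i \<in> carrier V"
  shows "finsum V f {..<a + b :: nat} = finsum V f {..<a} \<oplus> finsum V (\<lambda>i. f (a + i)) {..<b}"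
  by (induction b) (use assms in \<open>simp_all add: finsum_lessThan_Suc a_assoc finsum_closed Pi_def\<close>)

lemma finsum_const_smult:
  assumes "v \<in> carrier V"
  shows "(\<Oplus>i\<in>{..<k::nat}. c \<odot> v) = (of_nat k * c) \<odot> v"
  by (induction k) (use assms in \<open>simp_all add: finsum_lessThan_Suc smult_add_left Pi_def algebra_simps a_comm\<close>)

lemma norm_finsum_le:
  assumes "\<And>i. f i \<in> carrier V"
  shows "n (finsum V f {..<k::nat}) \<le> (\<Sum>i<k. n (f i))"
proof (induction k)
  case (Suc k)
  then show ?case
    using norm_triangle[of "finsum V f {..<k}" "f k"] assms
    by (simp add: finsum_lessThan_Suc finsum_closed Pi_def)
qed simp

lemma norm_finsum_diff_le:
  assumes "\<And>i. f i \<in> carrier V" "\<And>i. g i \<in> carrier V"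
  shows "n (finsum V f {..<k::nat} \<ominus> finsum V g {..<k}) \<le> (\<Sum>i<k. n (f i \<ominus> g i))"
proof (induction k)
  case (Suc k)
  then show ?case
    using norm_add_diff[of "finsum V f {..<k}" "f k" "finsum V g {..<k}" "g k"] assms
    by (simp add: finsum_lessThan_Suc finsum_closed Pi_def)
qed simp

text \<open>Completeness is assumed for sequences. Picking \<open>s i\<close> in the first
  \<open>i + 1\<close> of the sets on which the net varies by less than \<open>1 / (j + 1)\<close>
  gives a Cauchy sequence, and its limit serves the whole net because every point of the
  \<open>N\<close>-th set is close to some late \<open>s i\<close>.\<close>

lemma net_complete:
  assumes "F \<noteq> bot" and car: "\<And>a. R a \<in> carrier V"
    and cauchy: "\<And>e. e > 0 \<Longrightarrow> \<exists>P. eventually P F \<and> (\<forall>a b. P a \<longrightarrow> P b \<longrightarrow> n (R a \<ominus> R b) < e)"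
  shows "\<exists>l\<in>carrier V. ((\<lambda>a. n (R a \<ominus> l)) \<longlongrightarrow> 0) F"
proof -
  have "\<forall>i::nat. \<exists>P. eventually P F \<and> (\<forall>a b. P a \<longrightarrow> P b \<longrightarrow> n (R a \<ominus> R b) < inverse (real (Suc i)))"
    using cauchy by (simp add: of_nat_0_less_iff del: of_nat_Suc)
  then obtain P where P: "\<And>i::nat. eventually (P i) F"
    "\<And>i a b. P i a \<Longrightarrow> P i b \<Longrightarrow> n (R a \<ominus> R b) < inverse (real (Suc i))"
    by metis
  \<comment> \<open>Finitely many eventual properties hold jointly somewhere because the filter is
    proper.\<close>
  have "\<exists>a. \<forall>j\<le>i. P j a" for i
  proof -
    have "eventually (\<lambda>a. \<forall>j\<in>{..i}. P j a) F"
      using P(1) by (simp add: eventually_ball_finite)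
    then show ?thesis
      using eventually_happens'[OF assms(1)] by fastforce
  qed
  then obtain s where s: "\<And>i j. j \<le> i \<Longrightarrow> P j (s i)" by metis
  have "\<exists>l\<in>carrier V. (\<lambda>i. n (R (s i) \<ominus> l)) \<longlonglongrightarrow> 0"
  proof (rule complete)
    fix e :: real assume "e > 0"
    then obtain N where N: "inverse (real (Suc N)) < e" using reals_Archimedean by blast
    show "\<exists>N. \<forall>i\<ge>N. \<forall>k\<ge>N. n (R (s i) \<ominus> R (s k)) < e"
      using P(2)[OF s s, of N] N by (meson less_trans)
  qed (use car in auto)
  then obtain l where l: "l \<in> carrier V" "(\<lambda>i. n (R (s i) \<ominus> l)) \<longlonglongrightarrow> 0" by blast
  have "((\<lambda>a. n (R a \<ominus> l)) \<longlongrightarrow> 0) F"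
  proof (rule tendstoI)
    fix e :: real assume "e > 0"
    then obtain N where N: "inverse (real (Suc N)) < e / 2" using reals_Archimedean half_gt_zero by blast
    have "eventually (\<lambda>i. n (R (s i) \<ominus> l) < e / 2) sequentially"
      using order_tendstoD(2)[OF l(2), of "e / 2"] \<open>e > 0\<close> by simp
    then obtain i where i: "i \<ge> N" "n (R (s i) \<ominus> l) < e / 2"
      unfolding eventually_sequentially by (meson nle_le)
    from P(1)[of N] show "eventually (\<lambda>a. dist (n (R a \<ominus> l)) 0 < e) F"
    proof eventually_elim
      case (elim a)
      then show ?case
        using norm_diff_triangle[OF car car l(1), of a "s i"] P(2)[OF elim s[OF i(1)]] i(2) N l(1) car
        by simp
    qed
  qed
  with l(1) show ?thesis by blast
qed

subsection \<open>Vector-valued Riemann sums\<close>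

definition continuous_curve :: "(real \<Rightarrow> 'a) \<Rightarrow> bool"
  where "continuous_curve G \<longleftrightarrow> (\<forall>t\<ge>0. G t \<in> carrier V) \<and>
    (\<forall>t\<ge>0. \<forall>e>0. \<exists>d>0. \<forall>s\<ge>0. \<bar>s - t\<bar> < d \<longrightarrow> n (G s \<ominus> G t) < e)"

lemma continuous_curve_carrier: "continuous_curve G \<Longrightarrow> t \<ge> 0 \<Longrightarrow> G t \<in> carrier V"
  by (simp add: continuous_curve_def)

lemma continuous_curveD:
  assumes "continuous_curve G" "t \<ge> 0" "e > 0"
  obtains d where "d > 0" "\<And>s. s \<ge> 0 \<Longrightarrow> \<bar>s - t\<bar> < d \<Longrightarrow> n (G s \<ominus> G t) < e"
  using assms unfolding continuous_curve_def by meson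

lemma continuous_on_norm_curve:
  assumes "continuous_curve G"
  shows "continuous_on {0..} (\<lambda>s. n (G s))"
  unfolding continuous_on_iff
proof (intro ballI allI impI)
  fix t e :: real assume "t \<in> {0..}" "e > 0"
  then obtain d where d: "d > 0" "\<And>s. s \<ge> 0 \<Longrightarrow> \<bar>s - t\<bar> < d \<Longrightarrow> n (G s \<ominus> G t) < e"
    using continuous_curveD[OF assms, of t e] by auto
  have "dist (n (G s)) (n (G t)) < e" if "s \<in> {0..}" "dist s t < d" for s
    using that d(2)[of s] \<open>t \<in> {0..}\<close> continuous_curve_carrier[OF assms]
      abs_norm_diff_le[of "G s" "G t"] by (simp add: dist_real_def)
  then show "\<exists>d>0. \<forall>s\<in>{0..}. dist s t < d \<longrightarrow> dist (n (G s)) (n (G t)) < e"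
    using d(1) by blast
qed

text \<open>Encodes the variation of a carrier-valued curve in a real function of two real
  variables, to which the compactness theorem for metric types applies. The estimate is the
  four-point inequality, used in both directions.\<close>

lemma continuous_on_dist_curve:
  assumes "continuous_curve G"
  shows "continuous_on ({0..} \<times> {0..}) (\<lambda>x. n (G (fst x) \<ominus> G (snd x)))"
  unfolding continuous_on_iff
proof (intro ballI allI impI)
  fix x :: "real \<times> real" and e :: real assume x: "x \<in> {0..} \<times> {0..}" and "e > 0"
  obtain s t where st: "x = (s, t)" "s \<ge> 0" "t \<ge> 0" using x by auto
  note car = continuous_curve_carrier[OF assms]
  obtain d1 where d1: "d1 > 0" "\<And>u. u \<ge> 0 \<Longrightarrow> \<bar>u - s\<bar> < d1 \<Longrightarrow> n (G u \<ominus> G s) < e / 2"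
    using continuous_curveD[OF assms, of s "e / 2"] st \<open>e > 0\<close> by auto
  obtain d2 where d2: "d2 > 0" "\<And>u. u \<ge> 0 \<Longrightarrow> \<bar>u - t\<bar> < d2 \<Longrightarrow> n (G u \<ominus> G t) < e / 2"
    using continuous_curveD[OF assms, of t "e / 2"] st \<open>e > 0\<close> by auto
  have "dist (n (G (fst y) \<ominus> G (snd y))) (n (G s \<ominus> G t)) < e"
    if y: "y \<in> {0..} \<times> {0..}" "dist y x < min d1 d2" for y
  proof -
    obtain u v where uv: "y = (u, v)" "u \<ge> 0" "v \<ge> 0" using y(1) by auto
    have "\<bar>u - s\<bar> < d1" "\<bar>v - t\<bar> < d2"
      using y(2) dist_fst_le[of y x] dist_snd_le[of y x] by (simp_all add: uv st dist_real_def)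
    then have "n (G u \<ominus> G s) < e / 2" "n (G v \<ominus> G t) < e / 2"
      using d1 d2 uv by auto
    moreover have "n (G u \<ominus> G v) \<le> n (G u \<ominus> G s) + (n (G s \<ominus> G t) + n (G t \<ominus> G v))"
      using norm_diff_triangle[of "G u" "G s" "G v"] norm_diff_triangle[of "G s" "G t" "G v"]
        car uv st by simp
    moreover have "n (G s \<ominus> G t) \<le> n (G s \<ominus> G u) + (n (G u \<ominus> G v) + n (G v \<ominus> G t))"
      using norm_diff_triangle[of "G s" "G u" "G t"] norm_diff_triangle[of "G u" "G v" "G t"]
        car uv st by simp
    moreover have "n (G s \<ominus> G u) = n (G u \<ominus> G s)" "n (G t \<ominus> G v) = n (G v \<ominus> G t)"
      using norm_diff_commute car uv st by auto
    ultimately show ?thesis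
      by (simp add: uv dist_real_def)
  qed
  then show "\<exists>d>0. \<forall>y\<in>{0..} \<times> {0..}. dist y x < d \<longrightarrow>
      dist (n (G (fst y) \<ominus> G (snd y))) (n (G (fst x) \<ominus> G (snd x))) < e"
    using d1(1) d2(1) by (intro exI[of _ "min d1 d2"]) (auto simp: st)
qed

text \<open>
  The real function \<open>(s, t) \<mapsto> n (G s \<ominus> G t)\<close> is uniformly continuous on the square and vanishes on
  the diagonal.
\<close>

lemma continuous_curve_uniform:
  assumes "continuous_curve G" "e > 0"
  obtains d where "d > 0"
    "\<And>s t. s \<in> {0..b} \<Longrightarrow> t \<in> {0..b} \<Longrightarrow> \<bar>s - t\<bar> < d \<Longrightarrow> n (G s \<ominus> G t) < e"
proof -
  let ?D = "\<lambda>x. n (G (fst x) \<ominus> G (snd x))"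
  have "uniformly_continuous_on ({0..b} \<times> {0..b}) ?D"
    by (intro compact_uniformly_continuous continuous_on_subset[OF continuous_on_dist_curve[OF assms(1)]]
        compact_Times) auto
  then obtain d where d: "d > 0" "\<And>x y. x \<in> {0..b} \<times> {0..b} \<Longrightarrow> y \<in> {0..b} \<times> {0..b} \<Longrightarrow>
      dist y x < d \<Longrightarrow> dist (?D y) (?D x) < e"
    unfolding uniformly_continuous_on_def using assms(2) by metis
  show thesis
  proof (rule that[OF d(1)])
    fix s t assume st: "s \<in> {0..b}" "t \<in> {0..b}" "\<bar>s - t\<bar> < d"
    have "dist (?D (s, t)) (?D (t, t)) < e"
      by (rule d(2)) (use st in \<open>auto simp: dist_Pair_Pair dist_real_def\<close>)
    then show "n (G s \<ominus> G t) < e"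
      using st continuous_curve_carrier[OF assms(1)] by (simp add: dist_real_def)
  qed
qed

text \<open>The nodes and weights are those of \<open>riemann_sum\<close>, so norms of these sums
  are bounded termwise by scalar Riemann sums of \<open>n (G s)\<close>.\<close>

definition curve_sum :: "(real \<Rightarrow> 'a) \<Rightarrow> nat \<times> nat \<Rightarrow> 'a"
  where "curve_sum G = (\<lambda>(N, k). \<Oplus>i\<in>{..<N * 2 ^ k}. (1 / 2 ^ k) \<odot> G (real i / 2 ^ k))"

lemma curve_sum_carrier: "(\<And>t. t \<ge> 0 \<Longrightarrow> G t \<in> carrier V) \<Longrightarrow> curve_sum G a \<in> carrier V"
  by (cases a) (auto simp: curve_sum_def intro!: finsum_closed)

text \<open>Each term is cut into \<open>p\<close> equal pieces. The index \<open>i\<close> of a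
  piece remembers its term as \<open>i div p\<close>, which is \<open>M\<close> throughout the last
  block \<open>M * p + j\<close> with \<open>j < p\<close>.\<close>

lemma finsum_refine:
  assumes "\<And>i. g i \<in> carrier V" and "p > 0"
  shows "(\<Oplus>i\<in>{..<M}. c \<odot> g i) = (\<Oplus>i\<in>{..<M * p}. (c / of_nat p) \<odot> g (i div p))"
proof (induction M)
  case (Suc M)
  have "(\<Oplus>i\<in>{..<Suc M * p}. (c / of_nat p) \<odot> g (i div p))
      = (\<Oplus>i\<in>{..<M * p}. (c / of_nat p) \<odot> g (i div p))
        \<oplus> (\<Oplus>j\<in>{..<p}. (c / of_nat p) \<odot> g ((M * p + j) div p))"
    using finsum_lessThan_add[of "\<lambda>i. (c / of_nat p) \<odot> g (i div p)" "M * p" p] assms(1)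
    by (simp add: add.commute)
  also have "(\<Oplus>j\<in>{..<p}. (c / of_nat p) \<odot> g ((M * p + j) div p)) = (\<Oplus>j\<in>{..<p}. (c / of_nat p) \<odot> g M)"
    by (rule finsum_cong') (use assms in auto)
  also have "\<dots> = c \<odot> g M"
    using finsum_const_smult[OF assms(1), where k = p and c = "c / of_nat p"] assms(2) by simp
  finally show ?case
    using Suc.IH assms(1) by (simp add: finsum_lessThan_Suc Pi_def)
qed simp

text \<open>After the coarse sum is rewritten on the fine mesh, both sums have the same weights, and
  the fine node \<open>i / 2 ^ k'\<close> lies within one coarse cell of the node
  \<open>(i div p) / 2 ^ k\<close> it is compared with.\<close>

lemma curve_sum_refine:
  assumes "\<And>t. t \<ge> 0 \<Longrightarrow> G t \<in> carrier V"
    and e: "\<And>s t. s \<in> {0..real N} \<Longrightarrow> t \<in> {0..real N} \<Longrightarrow> \<bar>s - t\<bar> < d \<Longrightarrow> n (G s \<ominus> G t) < e"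
    and "1 / 2 ^ k < d" "k \<le> k'"
  shows "n (curve_sum G (N, k) \<ominus> curve_sum G (N, k')) \<le> real N * e"
proof -
  define p :: nat where "p = 2 ^ (k' - k)"
  have "p > 0" by (simp add: p_def)
  have p: "2 ^ k * p = 2 ^ k'" "2 ^ k * of_nat p = (2 ^ k' :: complex)" "2 ^ k * real p = 2 ^ k'"
    using \<open>k \<le> k'\<close> by (simp_all add: p_def flip: power_add)
  have fine: "curve_sum G (N, k)
      = (\<Oplus>i\<in>{..<N * 2 ^ k'}. (1 / 2 ^ k') \<odot> G (real (i div p) / 2 ^ k))"
    using finsum_refine[of "\<lambda>i. G (real i / 2 ^ k)" p "1 / 2 ^ k" "N * 2 ^ k"] assms(1) \<open>p > 0\<close>
    by (simp add: curve_sum_def p mult.assoc)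
  have "n (curve_sum G (N, k) \<ominus> curve_sum G (N, k'))
      \<le> (\<Sum>i<N * 2 ^ k'. n ((1 / 2 ^ k') \<odot> G (real (i div p) / 2 ^ k) \<ominus> (1 / 2 ^ k') \<odot> G (real i / 2 ^ k')))"
    unfolding fine unfolding curve_sum_def prod.case
    by (rule norm_finsum_diff_le) (use assms(1) in auto)
  also have "\<dots> \<le> (\<Sum>i<N * 2 ^ k'. e / 2 ^ k')"
  proof (rule sum_mono)
    fix i assume i: "i \<in> {..<N * 2 ^ k'}"
    define s where "s = real (i div p) / 2 ^ k"
    define t where "t = real i / 2 ^ k'"
    \<comment> \<open>Division with remainder of \<open>i\<close> by \<open>p\<close> shows
      \<open>t - s\<close> to be the fraction \<open>(i mod p) / p\<close> of a coarse cell.\<close>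
    have t: "t = (real (i div p) + real (i mod p) / real p) / 2 ^ k"
    proof -
      have "real i = real p * real (i div p) + real (i mod p)"
        by (metis mult_div_mod_eq of_nat_add of_nat_mult)
      then have "t = (real p * real (i div p) + real (i mod p)) / (2 ^ k * real p)"
        unfolding t_def p(3) by (rule arg_cong)
      also have "\<dots> = (real (i div p) + real (i mod p) / real p) / 2 ^ k"
        using \<open>p > 0\<close> by (simp add: add_divide_distrib)
      finally show ?thesis .
    qed
    have m: "real (i mod p) / real p \<le> 1" "0 \<le> real (i mod p) / real p"
      using \<open>p > 0\<close> by (auto simp: less_imp_le)
    have "t - s = real (i mod p) / real p / 2 ^ k"
      by (simp add: t s_def add_divide_distrib)
    moreover have "real (i mod p) / real p / 2 ^ k \<le> 1 / 2 ^ k"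
      using m(1) by (rule divide_right_mono) simp
    ultimately have st: "0 \<le> t - s" "t - s \<le> 1 / 2 ^ k"
      using m(2) by simp_all
    have "real i \<le> real N * 2 ^ k'"
      using i by (metis lessThan_iff less_imp_le of_nat_le_iff of_nat_mult of_nat_numeral of_nat_power)
    then have "t \<in> {0..real N}"
      by (simp add: t_def divide_le_eq)
    moreover have "0 \<le> s" by (simp add: s_def)
    ultimately have "t \<in> {0..real N}" "s \<in> {0..real N}"
      using st(1) by auto
    then have "n (G s \<ominus> G t) < e"
      using st assms(3) by (intro e) auto
    then show "n ((1 / 2 ^ k') \<odot> G (real (i div p) / 2 ^ k) \<ominus> (1 / 2 ^ k') \<odot> G (real i / 2 ^ k')) \<le> e / 2 ^ k'"
      unfolding s_def t_def
      using assms(1) by (simp add: norm_smult_diff norm_divide norm_power divide_right_mono)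
  qed
  finally show ?thesis by simp
qed

lemma norm_curve_sum_le:
  assumes "\<And>t. t \<ge> 0 \<Longrightarrow> G t \<in> carrier V"
  shows "n (curve_sum G a) \<le> riemann_sum (\<lambda>s. n (G s)) a"
proof (cases a)
  case (Pair N k)
  have "n (curve_sum G a) \<le> (\<Sum>i<N * 2 ^ k. n ((1 / 2 ^ k) \<odot> G (real i / 2 ^ k)))"
    unfolding Pair curve_sum_def prod.case by (rule norm_finsum_le) (use assms in auto)
  then show ?thesis
    using assms by (simp add: Pair riemann_sum_def norm_divide norm_power norm_inverse divide_inverse mult.commute)
qed

text \<open>The two sums share their mesh, so they differ exactly by the nodes in
  \<open>[N, N')\<close>. The norms of these terms add up to a piece of the scalar Riemann sum,
  which the convergent integral of \<open>n (G s)\<close> makes small.\<close>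

lemma norm_curve_sum_tail_le:
  assumes "\<And>t. t \<ge> 0 \<Longrightarrow> G t \<in> carrier V" and "N \<le> N'"
  shows "n (curve_sum G (N, k) \<ominus> curve_sum G (N', k))
    \<le> riemann_sum (\<lambda>s. n (G s)) (N', k) - riemann_sum (\<lambda>s. n (G s)) (N, k)"
proof -
  let ?f = "\<lambda>i. (1 / 2 ^ k) \<odot> G (real i / 2 ^ k)" and ?K = "N * 2 ^ k" and ?L = "(N' - N) * 2 ^ k"
  let ?h = "\<lambda>i. n (G (real i / 2 ^ k)) / 2 ^ k"
  have KL: "N' * 2 ^ k = ?K + ?L" using assms(2) by (simp add: flip: distrib_right)
  have car: "?f i \<in> carrier V" for i using assms(1) by auto
  have car': "finsum V ?f A \<in> carrier V" "finsum V (\<lambda>i. ?f (?K + i)) A \<in> carrier V" for A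
    using car by (auto intro!: finsum_closed simp del: of_nat_add)
  have "curve_sum G (N', k) = curve_sum G (N, k) \<oplus> finsum V (\<lambda>i. ?f (?K + i)) {..<?L}"
    unfolding curve_sum_def prod.case KL by (rule finsum_lessThan_add) (rule car)
  then have "n (curve_sum G (N, k) \<ominus> curve_sum G (N', k)) = n (finsum V (\<lambda>i. ?f (?K + i)) {..<?L})"
    using car' norm_diff_commute[of "curve_sum G (N, k)" "curve_sum G (N', k)"]
    by (simp add: curve_sum_def minus_eq a_ac r_neg1 l_neg r_neg2 del: of_nat_add)
  also have "\<dots> \<le> (\<Sum>i<?L. n (?f (?K + i)))"
    by (rule norm_finsum_le) (rule car)
  also have "\<dots> = (\<Sum>i<?L. ?h (?K + i))"
    using assms(1) by (simp add: norm_divide norm_power del: of_nat_add)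
  also have "\<dots> = (\<Sum>i<?K + ?L. ?h i) - (\<Sum>i<?K. ?h i)"
  proof -
    have "(\<Sum>i<a + b. ?h i) = (\<Sum>i<a. ?h i) + (\<Sum>i<b. ?h (a + i))" for a b
      by (induction b) (simp_all del: of_nat_add)
    then show ?thesis by simp
  qed
  finally show ?thesis
    by (simp add: riemann_sum_def KL divide_inverse mult.commute)
qed

text \<open>The Cauchy criterion is met in two moves: from \<open>(N, k)\<close> to
  \<open>(N, k')\<close> by uniform continuity on \<open>[0, N]\<close>, then from
  \<open>(N, k')\<close> to \<open>(N', k')\<close> by the tail of the scalar integral.\<close>

lemma curve_sum_convergent:
  assumes G: "continuous_curve G" and int: "integrable (lebesgue_on {0..}) (\<lambda>s. n (G s))"
  obtains u where "u \<in> carrier V" "((\<lambda>a. n (curve_sum G a \<ominus> u)) \<longlongrightarrow> 0) riemann_filter"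
    "n u \<le> (\<integral>s. n (G s) \<partial>lebesgue_on {0..})"
proof -
  let ?h = "\<lambda>s. n (G s)" and ?I = "\<integral>s. n (G s) \<partial>lebesgue_on {0..}"
  note car = continuous_curve_carrier[OF G]
  note scar = curve_sum_carrier[of G, OF car]
  have h: "continuous_on {0..real N} ?h" for N
    by (rule continuous_on_subset[OF continuous_on_norm_curve[OF G]]) auto
  have "\<exists>u\<in>carrier V. ((\<lambda>a. n (curve_sum G a \<ominus> u)) \<longlongrightarrow> 0) riemann_filter"
  proof (rule net_complete[OF riemann_filter_neq_bot scar])
    fix r :: real assume "r > 0"
    \<comment> \<open>One \<open>e\<close> pays for the change of mesh. Four pay for the tail: the
      errors of two Riemann sums and the distances of two truncated integrals from
      \<open>?I\<close>.\<close>
    define e where "e = r / 5"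
    have "e > 0" using \<open>r > 0\<close> by (simp add: e_def)
    have "\<forall>\<^sub>F N in sequentially. dist (integral {0..real N} ?h) ?I < e"
      using integral_halfline_limit[OF int] \<open>e > 0\<close> by (rule tendstoD)
    then obtain N0 where N0: "\<And>N. N \<ge> N0 \<Longrightarrow> \<bar>integral {0..real N} ?h - ?I\<bar> < e"
      unfolding eventually_sequentially dist_real_def by blast
    define A where "A M k \<longleftrightarrow> \<bar>riemann_sum ?h (M, k) - integral {0..real M} ?h\<bar> < e \<and>
      (\<forall>k'\<ge>k. n (curve_sum G (M, k) \<ominus> curve_sum G (M, k')) < e)" for M k
    have ev: "\<forall>\<^sub>F k in sequentially. A M k" for M
    proof -
      \<comment> \<open>\<open>curve_sum_refine\<close> multiplies the oscillation by the length
        \<open>M\<close> of the interval.\<close>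
      define e' where "e' = e / (real M + 1)"
      have "e' > 0" "real M * e' < e" using \<open>e > 0\<close> by (auto simp: e'_def field_simps)
      obtain d where d: "d > 0"
        "\<And>s t. s \<in> {0..real M} \<Longrightarrow> t \<in> {0..real M} \<Longrightarrow> \<bar>s - t\<bar> < d \<Longrightarrow> n (G s \<ominus> G t) < e'"
        using continuous_curve_uniform[OF G \<open>e' > 0\<close>] by blast
      have "(\<lambda>k. 1 / 2 ^ k :: real) \<longlonglongrightarrow> 0"
        using LIMSEQ_realpow_zero[of "1/2"] by (simp add: power_one_over)
      then have "\<forall>\<^sub>F k in sequentially. 1 / 2 ^ k < d"
        using d(1) by (rule order_tendstoD(2))
      moreover have "\<forall>\<^sub>F k in sequentially. dist (riemann_sum ?h (M, k)) (integral {0..real M} ?h) < e"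
        using riemann_sum_tendsto_integral[OF h] \<open>e > 0\<close> by (rule tendstoD)
      ultimately show ?thesis
      proof eventually_elim
        case (elim k)
        then show ?case
          using curve_sum_refine[of G M d e' k, OF car d(2) elim(1)] \<open>real M * e' < e\<close>
          by (force simp: A_def dist_real_def)
      qed
    qed
    \<comment> \<open>Demanding \<open>A M k\<close> for every \<open>M \<le> N\<close> lets a pair
      \<open>(N', k')\<close> with \<open>N \<le> N'\<close> guarantee \<open>A N k'\<close>, the
      accuracy of its mesh on the shorter interval.\<close>
    define P where "P = (\<lambda>(N, k). N \<ge> N0 \<and> (\<forall>M\<le>N. A M k))"
    have "eventually P riemann_filter"
      unfolding eventually_riemann_filter
      using eventually_ge_at_top[of N0]
    proof eventually_elim
      case (elim N)
      have "\<forall>\<^sub>F k in sequentially. \<forall>M\<in>{..N}. A M k"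
        using ev by (intro eventually_ball_finite) auto
      then show ?case
        using elim by (simp add: P_def Ball_def)
    qed
    moreover have close: "n (curve_sum G (N, k) \<ominus> curve_sum G (N', k')) < r"
      if P: "P (N, k)" "P (N', k')" and "N \<le> N'" for N k N' k'
    proof -
      have A: "A N k" "A N k'" "A N' k'" "N0 \<le> N" "N0 \<le> N'"
        using P \<open>N \<le> N'\<close> by (auto simp: P_def)
      have "n (curve_sum G (N, k) \<ominus> curve_sum G (N, k')) < e"
        using A(1,2) norm_diff_commute[OF scar scar, of "(N, k)" "(N, k')"]
        by (cases "k \<le> k'") (auto simp: A_def)
      moreover have "n (curve_sum G (N, k') \<ominus> curve_sum G (N', k'))
          \<le> riemann_sum ?h (N', k') - riemann_sum ?h (N, k')"
        by (rule norm_curve_sum_tail_le[OF car \<open>N \<le> N'\<close>])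
      moreover have "riemann_sum ?h (N', k') - riemann_sum ?h (N, k') < 4 * e"
        using A N0[OF A(4)] N0[OF A(5)] unfolding A_def by linarith
      moreover have "n (curve_sum G (N, k) \<ominus> curve_sum G (N', k'))
          \<le> n (curve_sum G (N, k) \<ominus> curve_sum G (N, k')) + n (curve_sum G (N, k') \<ominus> curve_sum G (N', k'))"
        by (rule norm_diff_triangle[OF scar scar scar])
      ultimately show ?thesis by (simp add: e_def)
    qed
    moreover have "n (curve_sum G a \<ominus> curve_sum G b) < r" if "P a" "P b" for a b
    proof (cases "fst a \<le> fst b")
      case True
      then show ?thesis using close[of "fst a" "snd a" "fst b" "snd b"] that by simp
    next
      case False
      then show ?thesis
        using close[of "fst b" "snd b" "fst a" "snd a"] that norm_diff_commute[OF scar scar, of a b] by simp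
    qed
    ultimately show "\<exists>P. eventually P riemann_filter \<and>
        (\<forall>a b. P a \<longrightarrow> P b \<longrightarrow> n (curve_sum G a \<ominus> curve_sum G b) < r)" by blast
  qed
  then obtain u where u: "u \<in> carrier V" "((\<lambda>a. n (curve_sum G a \<ominus> u)) \<longlongrightarrow> 0) riemann_filter"
    by blast
  \<comment> \<open>Along the filter the first summand tends to \<open>0\<close> and the second to
    \<open>?I\<close>, which gives the bound on \<open>n u\<close>.\<close>
  have bound: "n u \<le> n (curve_sum G a \<ominus> u) + riemann_sum ?h a" for a
    using norm_le_diff[OF u(1) scar, of a] norm_curve_sum_le[of G a, OF car]
      norm_diff_commute[OF u(1) scar, of a] by linarith
  have "((\<lambda>a. n (curve_sum G a \<ominus> u) + riemann_sum ?h a) \<longlongrightarrow> 0 + ?I) riemann_filter"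
    by (intro tendsto_add u(2) riemann_sum_tendsto continuous_on_norm_curve G int)
  moreover from bound have "\<forall>\<^sub>F a in riemann_filter. n u \<le> n (curve_sum G a \<ominus> u) + riemann_sum ?h a"
    by (intro always_eventually allI)
  ultimately have "n u \<le> 0 + ?I"
    using riemann_filter_neq_bot by (rule tendsto_lowerbound)
  then have "n u \<le> ?I" by simp
  with u show thesis by (rule that)
qed

end


section \<open>Seminorm topologies and continuous endomorphisms\<close>

lemma topspace_seminorm_topology [simp]: "topspace (seminorm_topology V P) = carrier V"
  by (auto simp: seminorm_topology_def)

lemma openin_seminorm_ball:
  assumes "p \<in> P" "u \<in> carrier V" "e > 0"
  shows "openin (seminorm_topology V P) {v \<in> carrier V. p (v \<ominus>\<^bsub>V\<^esub> u) < e}"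
  unfolding seminorm_topology_def
  by (rule topology_generated_by_Basis) (use assms in blast)

text \<open>Used on \<open>V\<close> for the norm and for the bundle seminorms, and on the operators
  for suprema over finite sets. The triangle inequality for differences is what can be checked
  directly in all three situations.\<close>

lemma seminorm_topology_nhd:
  assumes tri: "\<And>p u v w. p \<in> P \<Longrightarrow> u \<in> carrier V \<Longrightarrow> v \<in> carrier V \<Longrightarrow> w \<in> carrier V \<Longrightarrow>
      p (u \<ominus>\<^bsub>V\<^esub> w) \<le> p (u \<ominus>\<^bsub>V\<^esub> v) + p (v \<ominus>\<^bsub>V\<^esub> w)"
    and "openin (seminorm_topology V P) U" and "u \<in> U"
  shows "\<exists>Q e. finite Q \<and> Q \<subseteq> P \<and> e > 0 \<and>
    (\<forall>v\<in>carrier V. (\<forall>p\<in>Q. p (v \<ominus>\<^bsub>V\<^esub> u) < e) \<longrightarrow> v \<in> U)"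
proof -
  have u: "u \<in> carrier V"
    using openin_subset[OF assms(2)] assms(3) by auto
  let ?nhd = "\<lambda>U. \<exists>Q e. finite Q \<and> Q \<subseteq> P \<and> e > 0 \<and>
    (\<forall>v\<in>carrier V. (\<forall>p\<in>Q. p (v \<ominus>\<^bsub>V\<^esub> u) < e) \<longrightarrow> v \<in> U)"
  have "generate_topology_on (insert (carrier V)
      {{v \<in> carrier V. p (v \<ominus>\<^bsub>V\<^esub> u) < \<epsilon>} |p u \<epsilon>. p \<in> P \<and> u \<in> carrier V \<and> \<epsilon> > 0}) U"
    using assms(2) unfolding seminorm_topology_def by (rule openin_topology_generated_by)
  then have "u \<in> U \<longrightarrow> ?nhd U"
  proof induction
    case (Int a b)
    show ?case
    proof
      assume "u \<in> a \<inter> b"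
      then obtain Q e Q' e' where "finite Q" "Q \<subseteq> P" "e > 0" "finite Q'" "Q' \<subseteq> P" "e' > 0"
        and a: "\<And>v. v \<in> carrier V \<Longrightarrow> (\<forall>p\<in>Q. p (v \<ominus>\<^bsub>V\<^esub> u) < e) \<Longrightarrow> v \<in> a"
        and b: "\<And>v. v \<in> carrier V \<Longrightarrow> (\<forall>p\<in>Q'. p (v \<ominus>\<^bsub>V\<^esub> u) < e') \<Longrightarrow> v \<in> b"
        using Int.IH by auto
      then show "?nhd (a \<inter> b)"
        by (intro exI[of _ "Q \<union> Q'"] exI[of _ "min e e'"]) auto
    qed
  next
    case (UN K)
    then show ?case by (meson Union_iff)
  next
    case (Basis s)
    show ?case
    proof
      assume "u \<in> s"
      consider "s = carrier V" | p w r where "p \<in> P" "w \<in> carrier V" "r > 0"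
        "s = {v \<in> carrier V. p (v \<ominus>\<^bsub>V\<^esub> w) < r}"
        using Basis by auto
      then show "?nhd s"
      proof cases
        case 1
        then show ?thesis by (intro exI[of _ "{}"] exI[of _ 1]) auto
      next
        case 2
        \<comment> \<open>A subbasic ball is centred at some \<open>w\<close>; the radius left over
          at \<open>u\<close> is \<open>r - p (u \<ominus> w)\<close>, positive because
          \<open>u\<close> lies in the ball.\<close>
        have "v \<in> s" if "v \<in> carrier V" "p (v \<ominus>\<^bsub>V\<^esub> u) < r - p (u \<ominus>\<^bsub>V\<^esub> w)" for v
          using tri[OF 2(1) that(1) u 2(2)] that 2(4) by simp
        then show ?thesis
          using 2 \<open>u \<in> s\<close>
          by (intro exI[of _ "{p}"] exI[of _ "r - p (u \<ominus>\<^bsub>V\<^esub> w)"]) auto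
      qed
    qed
  qed simp
  with assms(3) show ?thesis by blast
qed

text \<open>For any \<open>r > q v\<close>, scaling \<open>v\<close> by \<open>e / r\<close> brings
  it into the \<open>q\<close>-ball of radius \<open>e\<close>. Letting \<open>r\<close> decrease to
  \<open>q v\<close>, instead of dividing by \<open>q v\<close>, also covers vectors with
  \<open>q v = 0\<close>.\<close>

lemma homogeneous_bound:
  fixes p q :: "'a \<Rightarrow> real"
  assumes "e > 0" "v \<in> carrier V" "q v \<ge> 0"
    and smult: "\<And>c v. v \<in> carrier V \<Longrightarrow> c \<odot>\<^bsub>V\<^esub> v \<in> carrier V"
    and "\<And>c v. v \<in> carrier V \<Longrightarrow> p (c \<odot>\<^bsub>V\<^esub> v) = cmod c * p v"
    and "\<And>c v. v \<in> carrier V \<Longrightarrow> q (c \<odot>\<^bsub>V\<^esub> v) = cmod c * q v"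
    and less: "\<And>v. v \<in> carrier V \<Longrightarrow> q v < e \<Longrightarrow> p v < 1"
  shows "p v \<le> (1 / e) * q v"
proof -
  have "e * p v \<le> q v"
  proof (rule dense_ge)
    fix r assume "q v < r"
    then have "r > 0" using assms(3) by linarith
    let ?c = "complex_of_real (e / r)"
    have "q (?c \<odot>\<^bsub>V\<^esub> v) = e * (q v / r)" "p (?c \<odot>\<^bsub>V\<^esub> v) = e * p v / r"
      using assms \<open>r > 0\<close> by (simp_all add: norm_divide)
    moreover have "e * (q v / r) < e"
      using \<open>q v < r\<close> \<open>r > 0\<close> \<open>e > 0\<close> by (simp add: field_simps)
    ultimately have "e * p v / r < 1"
      using less[OF smult, of v ?c] assms(2) by simp
    then show "e * p v \<le> r" using \<open>r > 0\<close> by (simp add: field_simps)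
  qed
  then show ?thesis using \<open>e > 0\<close> by (simp add: field_simps)
qed

section \<open>Bounded operators and their extension from a dense submodule\<close>

context banach_module
begin

abbreviation norm_topology :: "'a topology"
  where "norm_topology \<equiv> seminorm_topology V {n}"

abbreviation operators :: "(complex, 'a \<Rightarrow> 'a) module"
  where "operators \<equiv> endo_space V norm_topology"

lemma norm_topology_nhd:
  assumes "openin norm_topology U" "u \<in> U"
  obtains e where "e > 0" "\<And>v. v \<in> carrier V \<Longrightarrow> n (v \<ominus> u) < e \<Longrightarrow> v \<in> U"
proof -
  have "\<exists>Q e. finite Q \<and> Q \<subseteq> {n} \<and> e > 0 \<and>
      (\<forall>v\<in>carrier V. (\<forall>p\<in>Q. p (v \<ominus> u) < e) \<longrightarrow> v \<in> U)"
    by (rule seminorm_topology_nhd[OF _ assms]) (use norm_diff_triangle in auto)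
  then obtain Q e where "Q \<subseteq> {n}" "e > 0"
    "\<forall>v\<in>carrier V. (\<forall>p\<in>Q. p (v \<ominus> u) < e) \<longrightarrow> v \<in> U"
    by blast
  then show thesis by (intro that[of e]) auto
qed

lemma openin_norm_topology:
  assumes "U \<subseteq> carrier V"
    and "\<And>u. u \<in> U \<Longrightarrow> \<exists>e>0. \<forall>v\<in>carrier V. n (v \<ominus> u) < e \<longrightarrow> v \<in> U"
  shows "openin norm_topology U"
proof (subst openin_subopen, intro ballI)
  fix u assume "u \<in> U"
  then obtain e where e: "e > 0" "\<forall>v\<in>carrier V. n (v \<ominus> u) < e \<longrightarrow> v \<in> U"
    using assms(2) by blast
  then show "\<exists>T. openin norm_topology T \<and> u \<in> T \<and> T \<subseteq> U"
    using assms(1) \<open>u \<in> U\<close>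
    by (intro exI[of _ "{v \<in> carrier V. n (v \<ominus> u) < e}"] conjI openin_seminorm_ball) auto
qed

lemma linear_endoD:
  assumes "linear_endo V f"
  shows "v \<in> carrier V \<Longrightarrow> f v \<in> carrier V"
    and "u \<in> carrier V \<Longrightarrow> v \<in> carrier V \<Longrightarrow> f (u \<oplus> v) = f u \<oplus> f v"
    and "v \<in> carrier V \<Longrightarrow> f (c \<odot> v) = c \<odot> f v"
    and "u \<in> carrier V \<Longrightarrow> v \<in> carrier V \<Longrightarrow> f (u \<ominus> v) = f u \<ominus> f v"
  using assms by (auto simp: linear_endo_def minus_eq_smult)

lemma linear_endo_zero: "linear_endo V f \<Longrightarrow> f \<zero> = \<zero>"
  using linear_endoD(1)[of f \<zero>] linear_endoD(3)[of f \<zero> 0] by simp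

lemma continuous_map_linear_iff:
  assumes "linear_endo V f"
  shows "continuous_map norm_topology norm_topology f \<longleftrightarrow> (\<exists>C. \<forall>v\<in>carrier V. n (f v) \<le> C * n v)"
proof
  assume cont: "continuous_map norm_topology norm_topology f"
  let ?U = "{v \<in> topspace norm_topology. f v \<in> {w \<in> carrier V. n (w \<ominus> \<zero>) < 1}}"
  have "openin norm_topology ?U"
    by (rule openin_continuous_map_preimage[OF cont]) (rule openin_seminorm_ball, auto)
  moreover have "\<zero> \<in> ?U"
    using linear_endo_zero[OF assms] by simp
  ultimately obtain e where e: "e > 0" "\<And>v. v \<in> carrier V \<Longrightarrow> n (v \<ominus> \<zero>) < e \<Longrightarrow> v \<in> ?U"
    by (rule norm_topology_nhd) blast
  have "n (f v) \<le> (1 / e) * n v" if "v \<in> carrier V" for v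
    by (rule homogeneous_bound[where V = V and p = "\<lambda>v. n (f v)"])
       (use that e linear_endoD[OF assms] in auto)
  then show "\<exists>C. \<forall>v\<in>carrier V. n (f v) \<le> C * n v" by blast
next
  assume "\<exists>C. \<forall>v\<in>carrier V. n (f v) \<le> C * n v"
  then obtain C where C: "\<And>v. v \<in> carrier V \<Longrightarrow> n (f v) \<le> C * n v" by blast
  show "continuous_map norm_topology norm_topology f"
    unfolding continuous_map_def
  proof (intro conjI allI impI)
    show "f \<in> topspace norm_topology \<rightarrow> topspace norm_topology"
      using linear_endoD(1)[OF assms] by auto
    fix U assume U: "openin norm_topology U"
    show "openin norm_topology {v \<in> topspace norm_topology. f v \<in> U}"
    proof (rule openin_norm_topology)
      fix u assume u: "u \<in> {v \<in> topspace norm_topology. f v \<in> U}"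
      then obtain e where e: "e > 0" "\<And>w. w \<in> carrier V \<Longrightarrow> n (w \<ominus> f u) < e \<Longrightarrow> w \<in> U"
        using norm_topology_nhd[OF U] by blast
      \<comment> \<open>\<open>\<bar>C\<bar> + 1\<close> is a positive substitute for
        \<open>C\<close>, whose sign is not known.\<close>
      have "f v \<in> U" if v: "v \<in> carrier V" "n (v \<ominus> u) < e / (\<bar>C\<bar> + 1)" for v
      proof (rule e(2))
        have "n (f v \<ominus> f u) \<le> C * n (v \<ominus> u)"
          using C[of "v \<ominus> u"] linear_endoD(4)[OF assms, of v u] u v by simp
        also have "\<dots> \<le> (\<bar>C\<bar> + 1) * n (v \<ominus> u)"
          using u v by (intro mult_right_mono) auto
        also have "\<dots> < e"
          using v(2) by (simp add: field_simps)
        finally show "n (f v \<ominus> f u) < e" .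
      qed (use linear_endoD(1)[OF assms] v in auto)
      then show "\<exists>e>0. \<forall>v\<in>carrier V. n (v \<ominus> u) < e \<longrightarrow> v \<in> {v \<in> topspace norm_topology. f v \<in> U}"
        using e(1) by (intro exI[of _ "e / (\<bar>C\<bar> + 1)"]) auto
    qed auto
  qed
qed

lemma operators_carrier_iff:
  "f \<in> carrier operators \<longleftrightarrow> f \<in> extensional (carrier V) \<and> linear_endo V f \<and>
    (\<exists>C. \<forall>v\<in>carrier V. n (f v) \<le> C * n v)"
  using continuous_map_linear_iff[of f] by (auto simp: endo_space_def)

lemma operators_ops [simp]:
  "v \<in> carrier V \<Longrightarrow> (f \<oplus>\<^bsub>operators\<^esub> g) v = f v \<oplus> g v"
  "v \<in> carrier V \<Longrightarrow> (c \<odot>\<^bsub>operators\<^esub> f) v = c \<odot> f v"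
  "v \<in> carrier V \<Longrightarrow> \<zero>\<^bsub>operators\<^esub> v = \<zero>"
  by (simp_all add: endo_space_def)

lemma operators_linear: "f \<in> carrier operators \<Longrightarrow> linear_endo V f"
  by (simp add: operators_carrier_iff)

lemmas operatorsD = linear_endoD[OF operators_linear]

lemma operators_eqI:
  "f \<in> carrier operators \<Longrightarrow> g \<in> carrier operators \<Longrightarrow> (\<And>v. v \<in> carrier V \<Longrightarrow> f v = g v) \<Longrightarrow> f = g"
  by (auto simp: operators_carrier_iff intro: extensionalityI)

lemma operators_closed:
  shows "f \<in> carrier operators \<Longrightarrow> g \<in> carrier operators \<Longrightarrow> f \<oplus>\<^bsub>operators\<^esub> g \<in> carrier operators"
    and "f \<in> carrier operators \<Longrightarrow> c \<odot>\<^bsub>operators\<^esub> f \<in> carrier operators"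
    and "\<zero>\<^bsub>operators\<^esub> \<in> carrier operators"
proof -
  assume fg: "f \<in> carrier operators" "g \<in> carrier operators"
  then obtain C D where C: "\<And>v. v \<in> carrier V \<Longrightarrow> n (f v) \<le> C * n v"
    and D: "\<And>v. v \<in> carrier V \<Longrightarrow> n (g v) \<le> D * n v"
    by (auto simp: operators_carrier_iff)
  note f = operatorsD[OF fg(1)] and g = operatorsD[OF fg(2)]
  have "n (f v \<oplus> g v) \<le> (C + D) * n v" if "v \<in> carrier V" for v
    using norm_triangle[of "f v" "g v"] C[OF that] D[OF that] f(1) g(1) that by (simp add: distrib_right)
  then show "f \<oplus>\<^bsub>operators\<^esub> g \<in> carrier operators"
    unfolding operators_carrier_iff linear_endo_def
    using f g by (auto simp: endo_space_def a_ac smult_add_right)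
next
  assume f: "f \<in> carrier operators"
  then obtain C where C: "\<And>v. v \<in> carrier V \<Longrightarrow> n (f v) \<le> C * n v"
    by (auto simp: operators_carrier_iff)
  have "n (c \<odot> f v) \<le> (cmod c * C) * n v" if "v \<in> carrier V" for v
    using mult_left_mono[OF C[OF that], of "cmod c"] operatorsD(1)[OF f] that by (simp add: mult.assoc)
  then show "c \<odot>\<^bsub>operators\<^esub> f \<in> carrier operators"
    unfolding operators_carrier_iff linear_endo_def
    using operatorsD[OF f] by (auto simp: endo_space_def smult_add_right smult_smult mult.commute[of c] intro!: exI[of _ "cmod c * C"])
next
  show "\<zero>\<^bsub>operators\<^esub> \<in> carrier operators"
    unfolding operators_carrier_iff linear_endo_def
    by (auto simp: endo_space_def intro!: exI[of _ 0])
qed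

lemma operators_module: "Module.module cplx operators"
proof (rule moduleI)
  show "cring cplx" by (rule cring_from_type_algebra)
  show "abelian_group operators"
  proof (rule abelian_groupI)
    fix f assume f: "f \<in> carrier operators"
    have "((- 1) \<odot>\<^bsub>operators\<^esub> f) \<oplus>\<^bsub>operators\<^esub> f = \<zero>\<^bsub>operators\<^esub>"
    proof (rule operators_eqI)
      fix v assume "v \<in> carrier V"
      then show "(((- 1) \<odot>\<^bsub>operators\<^esub> f) \<oplus>\<^bsub>operators\<^esub> f) v = \<zero>\<^bsub>operators\<^esub> v"
        using operatorsD(1)[OF f, of v] by (simp add: l_neg flip: uminus_eq_smult)
    qed (use f operators_closed in auto)
    then show "\<exists>g\<in>carrier operators. g \<oplus>\<^bsub>operators\<^esub> f = \<zero>\<^bsub>operators\<^esub>"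
      using operators_closed(2)[OF f] by blast
  qed (use operators_closed operatorsD(1) in \<open>auto intro!: operators_eqI simp: a_ac\<close>)
qed (use operators_closed operatorsD(1) in
  \<open>auto intro!: operators_eqI simp: smult_add_left smult_add_right smult_smult\<close>)

lemma operators_minus:
  assumes "f \<in> carrier operators" "g \<in> carrier operators"
  shows "f \<ominus>\<^bsub>operators\<^esub> g \<in> carrier operators"
    and "v \<in> carrier V \<Longrightarrow> (f \<ominus>\<^bsub>operators\<^esub> g) v = f v \<ominus> g v"
    and "f \<ominus>\<^bsub>operators\<^esub> g = f \<oplus>\<^bsub>operators\<^esub> ((- 1) \<odot>\<^bsub>operators\<^esub> g)"
proof -
  interpret L: Module.module cplx operators by (rule operators_module)
  have "\<ominus>\<^bsub>operators\<^esub> g = (- 1) \<odot>\<^bsub>operators\<^esub> g"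
  proof (rule L.minus_equality)
    show "((- 1) \<odot>\<^bsub>operators\<^esub> g) \<oplus>\<^bsub>operators\<^esub> g = \<zero>\<^bsub>operators\<^esub>"
    proof (rule operators_eqI)
      fix v assume "v \<in> carrier V"
      then show "(((- 1) \<odot>\<^bsub>operators\<^esub> g) \<oplus>\<^bsub>operators\<^esub> g) v = \<zero>\<^bsub>operators\<^esub> v"
        using operatorsD(1)[OF assms(2), of v] by (simp add: l_neg flip: uminus_eq_smult)
    qed (use assms operators_closed in auto)
  qed (use assms operators_closed in auto)
  then show eq: "f \<ominus>\<^bsub>operators\<^esub> g = f \<oplus>\<^bsub>operators\<^esub> ((- 1) \<odot>\<^bsub>operators\<^esub> g)"
    by (simp add: L.minus_eq)
  show "f \<ominus>\<^bsub>operators\<^esub> g \<in> carrier operators"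
    unfolding eq using assms operators_closed by blast
  show "(f \<ominus>\<^bsub>operators\<^esub> g) v = f v \<ominus> g v" if "v \<in> carrier V"
    unfolding eq using that assms operatorsD(1) by (simp add: minus_eq_smult)
qed

lemma op_norm_bound:
  assumes f: "f \<in> carrier operators" and v: "v \<in> carrier V"
  shows "n (f v) \<le> op_norm V n f * n v"
proof (cases "n v = 0")
  case True
  then have "v = \<zero>" using norm_eq_zero v by blast
  then show ?thesis
    using linear_endo_zero[OF operators_linear[OF f]] by simp
next
  case False
  then have "n v > 0" using norm_nonneg[OF v] by linarith
  obtain C where C: "\<And>v. v \<in> carrier V \<Longrightarrow> n (f v) \<le> C * n v"
    using f by (auto simp: operators_carrier_iff)
  \<comment> \<open>\<open>op_norm\<close> is a real \<open>SUP\<close>, which dominates its members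
    only once the set is known to be bounded above; continuity of \<open>f\<close> provides the
    bound.\<close>
  have "bdd_above ((\<lambda>v. n (f v)) ` {v \<in> carrier V. n v \<le> 1})"
  proof (rule bdd_aboveI2[where M = "\<bar>C\<bar>"])
    fix u assume u: "u \<in> {v \<in> carrier V. n v \<le> 1}"
    have "n (f u) \<le> \<bar>C\<bar> * n u"
      using C[of u] u by (smt (verit) mem_Collect_eq mult_right_mono norm_nonneg)
    also have "\<dots> \<le> \<bar>C\<bar> * 1" using u by (intro mult_left_mono) auto
    finally show "n (f u) \<le> \<bar>C\<bar>" by simp
  qed
  moreover define u where "u = complex_of_real (1 / n v) \<odot> v"
  moreover have "n u = 1" "u \<in> carrier V"
    using v \<open>n v > 0\<close> by (simp_all add: u_def norm_divide)
  ultimately have "n (f u) \<le> op_norm V n f"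
    unfolding op_norm_def by (intro cSUP_upper) auto
  then show ?thesis
    using v \<open>n v > 0\<close> operatorsD(1,3)[OF f] by (simp add: u_def norm_divide field_simps)
qed

text \<open>Extension by density and completeness. A value \<open>w\<close> at \<open>v\<close> is
  specified by \<open>n (g d \<ominus> w) \<le> C * n (d \<ominus> v)\<close> for all
  \<open>d\<close> in \<open>D\<close> and not as a limit, so linearity and boundedness follow from
  estimates at nearby points of \<open>D\<close>, with no further sequences.\<close>

lemma bounded_extension:
  assumes "submodule D cplx V"
    and dense: "\<And>v e. v \<in> carrier V \<Longrightarrow> e > 0 \<Longrightarrow> \<exists>d\<in>D. n (d \<ominus> v) < e"
    and g: "\<And>v. v \<in> D \<Longrightarrow> g v \<in> carrier V"
      "\<And>u v. u \<in> D \<Longrightarrow> v \<in> D \<Longrightarrow> g (u \<oplus> v) = g u \<oplus> g v"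
      "\<And>c v. v \<in> D \<Longrightarrow> g (c \<odot> v) = c \<odot> g v"
    and "C \<ge> 0" and bound: "\<And>v. v \<in> D \<Longrightarrow> n (g v) \<le> C * n v"
  obtains f where "f \<in> carrier operators" "\<And>v. v \<in> D \<Longrightarrow> f v = g v"
proof -
  have D: "v \<in> D \<Longrightarrow> v \<in> carrier V" "u \<in> D \<Longrightarrow> v \<in> D \<Longrightarrow> u \<oplus> v \<in> D" "v \<in> D \<Longrightarrow> c \<odot> v \<in> D" for u v c
    using submoduleE[OF assms(1)] by auto
  have lip: "n (g u \<ominus> g v) \<le> C * n (u \<ominus> v)" if "u \<in> D" "v \<in> D" for u v
    using bound[of "u \<oplus> (- 1) \<odot> v"] that D g by (simp add: minus_eq_smult)
  have ex: "\<exists>w. w \<in> carrier V \<and> (\<forall>d\<in>D. n (g d \<ominus> w) \<le> C * n (d \<ominus> v))" if v: "v \<in> carrier V" for v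
  proof -
    have "\<forall>i::nat. \<exists>d\<in>D. n (d \<ominus> v) < inverse (real (Suc i))"
      using dense[OF v] by (simp del: of_nat_Suc)
    then obtain s where s: "\<And>i. s i \<in> D" "\<And>i. n (s i \<ominus> v) < inverse (real (Suc i))"
      by metis
    have lim: "(\<lambda>i. n (s i \<ominus> v)) \<longlonglongrightarrow> 0"
      by (rule Lim_null_comparison[OF _ LIMSEQ_inverse_real_of_nat])
         (use s D v in \<open>auto intro!: always_eventually less_imp_le simp del: of_nat_Suc\<close>)
    have "\<exists>w\<in>carrier V. (\<lambda>i. n (g (s i) \<ominus> w)) \<longlonglongrightarrow> 0"
    proof (rule complete)
      fix e :: real assume "e > 0"
      \<comment> \<open>Two terms of the sequence are at most \<open>2 * e'\<close> apart and
        \<open>g\<close> stretches this by \<open>C\<close>; \<open>C + 1\<close> keeps the divisor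
        positive.\<close>
      define e' where "e' = e / (2 * (C + 1))"
      have "e' > 0" using \<open>e > 0\<close> \<open>C \<ge> 0\<close> by (simp add: e'_def)
      then obtain N where N: "\<And>i. i \<ge> N \<Longrightarrow> n (s i \<ominus> v) < e'"
        using order_tendstoD(2)[OF lim] unfolding eventually_sequentially by meson
      have "n (g (s i) \<ominus> g (s k)) < e" if "i \<ge> N" "k \<ge> N" for i k
      proof -
        have "n (s i \<ominus> s k) \<le> 2 * e'"
          using norm_diff_triangle[of "s i" v "s k"] norm_diff_commute[of v "s k"]
            N[OF that(1)] N[OF that(2)] s(1) D(1) v by fastforce
        then have "C * n (s i \<ominus> s k) \<le> C * (2 * e')"
          using \<open>C \<ge> 0\<close> by (rule mult_left_mono)
        also have "\<dots> < e"
          using \<open>C \<ge> 0\<close> \<open>e > 0\<close> by (simp add: e'_def field_simps)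
        finally show ?thesis using lip[OF s(1) s(1), of i k] by linarith
      qed
      then show "\<exists>N. \<forall>i\<ge>N. \<forall>k\<ge>N. n (g (s i) \<ominus> g (s k)) < e" by blast
    qed (use s g in auto)
    then obtain w where w: "w \<in> carrier V" "(\<lambda>i. n (g (s i) \<ominus> w)) \<longlonglongrightarrow> 0" by blast
    have "n (g d \<ominus> w) \<le> C * n (d \<ominus> v)" if d: "d \<in> D" for d
    proof -
      have "n (g d \<ominus> w) \<le> C * (n (d \<ominus> v) + n (s i \<ominus> v)) + n (g (s i) \<ominus> w)" for i
      proof -
        have "n (g d \<ominus> w) \<le> n (g d \<ominus> g (s i)) + n (g (s i) \<ominus> w)"
          by (rule norm_diff_triangle) (use d g s w in auto)
        moreover have "n (g d \<ominus> g (s i)) \<le> C * n (d \<ominus> s i)" by (rule lip[OF d s(1)])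
        moreover have "C * n (d \<ominus> s i) \<le> C * (n (d \<ominus> v) + n (s i \<ominus> v))"
          using norm_diff_triangle[of d v "s i"] norm_diff_commute[of v "s i"] d s(1) D(1) v \<open>C \<ge> 0\<close>
          by (intro mult_left_mono) auto
        ultimately show ?thesis by linarith
      qed
      moreover have "(\<lambda>i. C * (n (d \<ominus> v) + n (s i \<ominus> v)) + n (g (s i) \<ominus> w)) \<longlonglongrightarrow> C * (n (d \<ominus> v) + 0) + 0"
        by (intro tendsto_intros lim w)
      ultimately have "n (g d \<ominus> w) \<le> C * (n (d \<ominus> v) + 0) + 0"
        by (intro LIMSEQ_le_const) auto
      then show ?thesis by simp
    qed
    with w(1) show ?thesis by blast
  qed
  \<comment> \<open>The Lipschitz estimate against all of \<open>D\<close> determines the value of the extension at \<open>v\<close>.\<close>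
  define f where "f = (\<lambda>v\<in>carrier V. SOME w. w \<in> carrier V \<and> (\<forall>d\<in>D. n (g d \<ominus> w) \<le> C * n (d \<ominus> v)))"
  have f: "f v \<in> carrier V" "\<And>d. d \<in> D \<Longrightarrow> n (g d \<ominus> f v) \<le> C * n (d \<ominus> v)" if "v \<in> carrier V" for v
    using someI_ex[OF ex[OF that]] that by (auto simp: f_def)
  \<comment> \<open>Taking \<open>d = v\<close> makes the right-hand side of the specification
    vanish.\<close>
  have fg: "f v = g v" if "v \<in> D" for v
    using eq_if_norm_diff_le[of "g v" "f v"] f(1)[of v] f(2)[of v v] g(1)[OF that] D(1)[OF that] that by simp
  have zeroI: "x = y" if "x \<in> carrier V" "y \<in> carrier V" "K \<ge> 0" "\<And>e. e > 0 \<Longrightarrow> n (x \<ominus> y) \<le> K * e" for x y K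
  proof (rule eq_if_norm_diff_le[OF that(1,2)], rule field_le_epsilon)
    fix e :: real assume "e > 0"
    then have "n (x \<ominus> y) \<le> K * (e / (K + 1))" using that(3) by (intro that(4)) simp
    also have "\<dots> \<le> e" using that(3) \<open>e > 0\<close> by (simp add: field_simps)
    finally show "n (x \<ominus> y) \<le> 0 + e" by simp
  qed
  have "f \<in> carrier operators"
    unfolding operators_carrier_iff linear_endo_def
  proof (intro conjI ballI allI exI)
    fix u v assume u: "u \<in> carrier V" and v: "v \<in> carrier V"
    show "f (u \<oplus> v) = f u \<oplus> f v"
    \<comment> \<open>\<open>2 * C\<close> for comparing \<open>g (a \<oplus> b)\<close> with
      \<open>f (u \<oplus> v)\<close>, and another \<open>2 * C\<close> for comparing it with
      \<open>f u \<oplus> f v\<close>.\<close>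
    proof (rule zeroI[of _ _ "4 * C"])
      fix e :: real assume "e > 0"
      obtain a where a: "a \<in> D" "n (a \<ominus> u) < e" using dense[OF u \<open>e > 0\<close>] by blast
      obtain b where b: "b \<in> D" "n (b \<ominus> v) < e" using dense[OF v \<open>e > 0\<close>] by blast
      have 1: "n (g (a \<oplus> b) \<ominus> f (u \<oplus> v)) \<le> C * (2 * e)"
      proof -
        have "n ((a \<oplus> b) \<ominus> (u \<oplus> v)) \<le> 2 * e"
          using norm_add_diff[of a b u v] a b u v D by fastforce
        then have "C * n ((a \<oplus> b) \<ominus> (u \<oplus> v)) \<le> C * (2 * e)"
          using \<open>C \<ge> 0\<close> by (rule mult_left_mono)
        then show ?thesis using f(2)[of "u \<oplus> v" "a \<oplus> b"] a b u v D by fastforce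
      qed
      have 2: "n (g (a \<oplus> b) \<ominus> (f u \<oplus> f v)) \<le> C * e + C * e"
        using norm_add_diff[of "g a" "g b" "f u" "f v"] f(2)[OF u a(1)] f(2)[OF v b(1)]
          mult_left_mono[OF less_imp_le[OF a(2)] \<open>C \<ge> 0\<close>] mult_left_mono[OF less_imp_le[OF b(2)] \<open>C \<ge> 0\<close>]
          f(1) g a b u v by simp
      have "n (f (u \<oplus> v) \<ominus> (f u \<oplus> f v))
          \<le> n (g (a \<oplus> b) \<ominus> f (u \<oplus> v)) + n (g (a \<oplus> b) \<ominus> (f u \<oplus> f v))"
        using norm_diff_triangle[of "f (u \<oplus> v)" "g (a \<oplus> b)" "f u \<oplus> f v"]
          norm_diff_commute[of "f (u \<oplus> v)" "g (a \<oplus> b)"] f(1) g(1) a b u v D by simp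
      with 1 2 show "n (f (u \<oplus> v) \<ominus> (f u \<oplus> f v)) \<le> 4 * C * e" by simp
    qed (use u v f(1) \<open>C \<ge> 0\<close> in auto)
  next
    fix c v assume v: "v \<in> carrier V"
    show "f (c \<odot> v) = c \<odot> f v"
    proof (rule zeroI[of _ _ "2 * (cmod c * C)"])
      fix e :: real assume "e > 0"
      obtain a where a: "a \<in> D" "n (a \<ominus> v) < e" using dense[OF v \<open>e > 0\<close>] by blast
      have C: "C * n (a \<ominus> v) \<le> C * e"
        using a(2) \<open>C \<ge> 0\<close> by (intro mult_left_mono) auto
      have 1: "n (g (c \<odot> a) \<ominus> f (c \<odot> v)) \<le> cmod c * (C * e)"
        using f(2)[of "c \<odot> v" "c \<odot> a"] norm_smult_diff[of a v c] a v D mult_left_mono[OF C, of "cmod c"]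
        by (simp add: mult.left_commute)
      have 2: "n (g (c \<odot> a) \<ominus> c \<odot> f v) \<le> cmod c * (C * e)"
        using norm_smult_diff[of "g a" "f v" c] f[OF v] g a C
          mult_left_mono[of "n (g a \<ominus> f v)" "C * e" "cmod c"] by fastforce
      have "n (f (c \<odot> v) \<ominus> c \<odot> f v) \<le> n (g (c \<odot> a) \<ominus> f (c \<odot> v)) + n (g (c \<odot> a) \<ominus> c \<odot> f v)"
        using norm_diff_triangle[of "f (c \<odot> v)" "g (c \<odot> a)" "c \<odot> f v"]
          norm_diff_commute[of "f (c \<odot> v)" "g (c \<odot> a)"] f(1) g(1) a v D by simp
      with 1 2 show "n (f (c \<odot> v) \<ominus> c \<odot> f v) \<le> 2 * (cmod c * C) * e" by simp
    qed (use v f(1) \<open>C \<ge> 0\<close> in auto)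
  next
    fix v assume v: "v \<in> carrier V"
    show "n (f v) \<le> C * n v"
    proof (rule field_le_epsilon)
      fix e :: real assume "e > 0"
      \<comment> \<open>The error \<open>C * n (a \<ominus> v)\<close> enters twice, once in
        \<open>n (g a \<ominus> f v)\<close> and once in \<open>n (g a)\<close>.\<close>
      define e' where "e' = e / (2 * (C + 1))"
      have "e' > 0" "2 * (C * e') \<le> e" using \<open>e > 0\<close> \<open>C \<ge> 0\<close> by (auto simp: e'_def field_simps)
      obtain a where a: "a \<in> D" "n (a \<ominus> v) < e'" using dense[OF v \<open>e' > 0\<close>] by blast
      have "C * n (a \<ominus> v) \<le> C * e'"
        using a(2) \<open>C \<ge> 0\<close> by (intro mult_left_mono) auto
      moreover have "n (f v) \<le> n (g a \<ominus> f v) + n (g a)"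
        using norm_le_diff[of "f v" "g a"] norm_diff_commute[of "f v" "g a"] f(1)[OF v] g(1)[OF a(1)] by simp
      moreover have "n (g a) \<le> C * n v + C * n (a \<ominus> v)"
        using bound[OF a(1)] mult_left_mono[OF norm_le_diff[of a v] \<open>C \<ge> 0\<close>] a v D(1)
        by (simp add: distrib_left)
      ultimately show "n (f v) \<le> C * n v + e"
        using f(2)[OF v a(1)] \<open>2 * (C * e') \<le> e\<close> by linarith
    qed
  qed (use f(1) in \<open>auto simp: f_def\<close>)
  then show thesis using fg by (rule that)
qed

end


section \<open>Uniform convergence on finite sets\<close>

lemma sup0_upper: "finite A \<Longrightarrow> v \<in> A \<Longrightarrow> g v \<le> sup0 A g"
  unfolding sup0_def by (intro cSup_upper) auto

text \<open>Over a finite set the supremum is a maximum, so strictness survives;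
  \<open>e > 0\<close> accounts for the \<open>0\<close> inserted by \<open>sup0\<close>.\<close>

lemma sup0_less: "finite A \<Longrightarrow> e > 0 \<Longrightarrow> (\<And>v. v \<in> A \<Longrightarrow> g v < e) \<Longrightarrow> sup0 A g < e"
  unfolding sup0_def by (subst cSup_eq_Max) auto

lemma sup0_least: "b \<ge> 0 \<Longrightarrow> (\<And>v. v \<in> A \<Longrightarrow> g v \<le> b) \<Longrightarrow> sup0 A g \<le> b"
  unfolding sup0_def by (intro cSup_least) auto

lemma sup0_nonneg: "finite A \<Longrightarrow> 0 \<le> sup0 A g"
  unfolding sup0_def by (intro cSup_upper) auto

text \<open>\<open>P\<close> stands for the bundle seminorms on a stalk and \<open>n\<close> for its
  Banach norm. The topology on operators is defined through \<open>P\<close>, whereas completeness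
  and the integral estimates live in \<open>n\<close>; \<open>P_topology\<close> is the link between
  them.\<close>

locale pointwise_operators = banach_module V n for V :: "(complex, 'a) module" (structure) and n +
  fixes P :: "('a \<Rightarrow> real) set" and S :: "'a set set"
  assumes P_seminorm: "p \<in> P \<Longrightarrow> seminorm V p"
    and P_nonempty: "P \<noteq> {}"
    and P_directed: "p \<in> P \<Longrightarrow> q \<in> P \<Longrightarrow> \<exists>r\<in>P. \<forall>v\<in>carrier V. p v \<le> r v \<and> q v \<le> r v"
    and P_topology: "seminorm_topology V P = seminorm_topology V {n}"
    and S_finite: "S \<subseteq> Fpow (carrier V)"
    and S_total: "total_in V (seminorm_topology V {n}) (\<Union>S)"
begin

abbreviation pointwise_topology :: "('a \<Rightarrow> 'a) topology"
  where "pointwise_topology \<equiv> endo_topology V norm_topology P S"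

lemma S_member: "A \<in> S \<Longrightarrow> finite A" "A \<in> S \<Longrightarrow> v \<in> A \<Longrightarrow> v \<in> carrier V"
  using S_finite by (auto simp: Fpow_def)

lemma P_zero:
  assumes "p \<in> P" shows "p \<zero> = 0"
proof -
  have "p (0 \<odot> \<zero>) = cmod 0 * p \<zero>"
    using P_seminorm[OF assms] zero_closed unfolding seminorm_def by blast
  then show ?thesis by simp
qed

lemma P_le_norm:
  assumes "p \<in> P"
  obtains C where "C > 0" "\<And>v. v \<in> carrier V \<Longrightarrow> p v \<le> C * n v"
proof -
  let ?U = "{v \<in> carrier V. p (v \<ominus> \<zero>) < 1}"
  have z: "v \<ominus> \<zero> = v" if "v \<in> carrier V" for v
    using that by (simp add: minus_eq_smult)
  have "openin norm_topology ?U"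
    unfolding P_topology[symmetric] by (rule openin_seminorm_ball) (use assms in auto)
  moreover have "\<zero> \<in> ?U"
    using P_zero[OF assms] by (simp add: z)
  ultimately obtain e where e: "e > 0" "\<And>v. v \<in> carrier V \<Longrightarrow> n (v \<ominus> \<zero>) < e \<Longrightarrow> v \<in> ?U"
    by (rule norm_topology_nhd) blast
  have "p v \<le> (1 / e) * n v" if "v \<in> carrier V" for v
    by (rule homogeneous_bound[where V = V])
       (use that e P_seminorm[OF assms] in \<open>auto simp: seminorm_def z\<close>)
  then show thesis using e(1) by (intro that[of "1 / e"]) auto
qed

lemma P_finite_bound:
  assumes "finite Q" "Q \<subseteq> P"
  shows "\<exists>r\<in>P. \<forall>p\<in>Q. \<forall>v\<in>carrier V. p v \<le> r v"
  using assms
proof (induction Q)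
  case empty
  then show ?case using P_nonempty by auto
next
  case (insert q Q)
  then obtain r where r: "r \<in> P" "\<forall>p\<in>Q. \<forall>v\<in>carrier V. p v \<le> r v" by auto
  obtain r' where "r' \<in> P" "\<forall>v\<in>carrier V. r v \<le> r' v \<and> q v \<le> r' v"
    using P_directed[of r q] r insert.prems by auto
  with r show ?case by (intro bexI[of _ r']) (auto intro: order_trans)
qed

text \<open>The unit ball of the norm is open for \<open>P\<close>, hence contains a finite
  intersection of \<open>P\<close>-balls around zero; directedness replaces the finitely many
  seminorms by one.\<close>

lemma norm_le_P:
  obtains p C where "p \<in> P" "C > 0" "\<And>v. v \<in> carrier V \<Longrightarrow> n v \<le> C * p v"
proof -
  let ?U = "{v \<in> carrier V. n (v \<ominus> \<zero>) < 1}"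
  have z: "v \<ominus> \<zero> = v" if "v \<in> carrier V" for v
    using that by (simp add: minus_eq_smult)
  have "openin (seminorm_topology V P) ?U"
    unfolding P_topology by (rule openin_seminorm_ball) auto
  then have "\<exists>Q e. finite Q \<and> Q \<subseteq> P \<and> e > 0 \<and>
      (\<forall>v\<in>carrier V. (\<forall>p\<in>Q. p (v \<ominus> \<zero>) < e) \<longrightarrow> v \<in> ?U)"
    by (rule seminorm_topology_nhd[rotated]) (simp_all add: seminorm_diff_triangle[OF P_seminorm])
  then obtain Q e where Q: "finite Q" "Q \<subseteq> P" "e > 0"
    "\<forall>v\<in>carrier V. (\<forall>p\<in>Q. p (v \<ominus> \<zero>) < e) \<longrightarrow> v \<in> ?U"
    by blast
  obtain r where r: "r \<in> P" "\<forall>p\<in>Q. \<forall>v\<in>carrier V. p v \<le> r v"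
    using P_finite_bound[OF Q(1,2)] by blast
  have "n v \<le> (1 / e) * r v" if v: "v \<in> carrier V" for v
  proof (rule homogeneous_bound[where V = V])
    show "n v < 1" if "v \<in> carrier V" "r v < e" for v
    proof -
      have "\<forall>p\<in>Q. p (v \<ominus> \<zero>) < e" using r(2) that by (fastforce simp: z)
      then show ?thesis using Q(4) that(1) by (auto simp: z)
    qed
  qed (use v Q(3) P_seminorm[OF r(1)] in \<open>auto simp: seminorm_def\<close>)
  then show thesis using r(1) Q(3) by (intro that[of r "1 / e"]) auto
qed

lemma topspace_pointwise [simp]: "topspace pointwise_topology = carrier operators"
  by (simp add: endo_topology_def)

text \<open>A vector of \<open>A\<close> is among the points of the supremum over \<open>A\<close>,
  so one seminorm of the topology controls \<open>p (F s v \<ominus> F t v)\<close>; the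
  \<open>p\<close> chosen is the one that dominates the norm up to \<open>C\<close>, hence the
  radius \<open>e / C\<close> below.\<close>

lemma pointwise_continuous_curve:
  assumes F: "continuous_map Rplus pointwise_topology F" and v: "v \<in> \<Union>S"
  shows "continuous_curve (\<lambda>s. F s v)"
proof -
  obtain A where A: "A \<in> S" "v \<in> A" using v by blast
  have Fs: "F s \<in> carrier operators" if "s \<ge> 0" for s
    using continuous_map_image_subset_topspace[OF F] that by auto
  have vV: "v \<in> carrier V" using S_member A by blast
  obtain p C where p: "p \<in> P" "C > 0" "\<And>v. v \<in> carrier V \<Longrightarrow> n v \<le> C * p v"
    using norm_le_P by blast
  let ?q = "\<lambda>f. sup0 A (\<lambda>v. p (f v))"
  have "\<exists>d>0. \<forall>s\<ge>0. \<bar>s - t\<bar> < d \<longrightarrow> n (F s v \<ominus> F t v) < e" if "t \<ge> 0" "e > 0" for t e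
  proof -
    let ?B = "{f \<in> carrier operators. ?q (f \<ominus>\<^bsub>operators\<^esub> F t) < e / C}"
    have "openin pointwise_topology ?B"
      unfolding endo_topology_def
      by (rule openin_seminorm_ball) (use A p that Fs in auto)
    then have op: "openin Rplus {s \<in> topspace Rplus. F s \<in> ?B}"
      by (rule openin_continuous_map_preimage[OF F])
    have "p ((F t \<ominus>\<^bsub>operators\<^esub> F t) u) = 0" if "u \<in> A" for u
      using operators_minus(2)[OF Fs Fs, of t t u] \<open>t \<ge> 0\<close> S_member A that operatorsD(1)[OF Fs, of t u]
      by (simp add: minus_eq r_neg P_zero[OF p(1)])
    then have "?q (F t \<ominus>\<^bsub>operators\<^esub> F t) < e / C"
      using S_member(1)[OF A(1)] that p(2) by (intro sup0_less) auto
    then have tB: "F t \<in> ?B" using that Fs by simp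
    obtain N where N: "open N" "{s \<in> topspace Rplus. F s \<in> ?B} = {0..} \<inter> N"
      using op unfolding openin_open by (elim exE conjE)
    have NB: "s \<in> N \<longleftrightarrow> F s \<in> ?B" if "s \<ge> 0" for s
    proof -
      have "s \<in> {0..} \<inter> N \<longleftrightarrow> F s \<in> ?B" unfolding N(2)[symmetric] using that by simp
      then show ?thesis using that by simp
    qed
    have "t \<in> N" using NB[OF \<open>t \<ge> 0\<close>] tB by (rule iffD2)
    then obtain d where d: "d > 0" "ball t d \<subseteq> N"
      using N(1) open_contains_ball by metis
    have FB: "F s \<in> ?B" if "s \<ge> 0" "\<bar>s - t\<bar> < d" for s
      using NB[OF that(1)] d(2) that(2) by (metis (lifting) dist_real_def dist_commute mem_ball subsetD)
    have "n (F s v \<ominus> F t v) < e" if s: "s \<ge> 0" "\<bar>s - t\<bar> < d" for s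
    proof -
      have "n (F s v \<ominus> F t v) \<le> C * p (F s v \<ominus> F t v)"
        using operatorsD(1)[OF Fs] s \<open>t \<ge> 0\<close> vV by (intro p(3)) auto
      also have "p (F s v \<ominus> F t v) \<le> ?q (F s \<ominus>\<^bsub>operators\<^esub> F t)"
        using sup0_upper[OF S_member(1)[OF A(1)] A(2), of "\<lambda>v. p ((F s \<ominus>\<^bsub>operators\<^esub> F t) v)"]
          operators_minus(2)[OF Fs Fs vV, of s t] s \<open>t \<ge> 0\<close> by simp
      also have "\<dots> < e / C" using FB[OF s] by simp
      finally show ?thesis using p(2) by (simp add: field_simps)
    qed
    then show ?thesis using d(1) by blast
  qed
  then show ?thesis
    unfolding continuous_curve_def using operatorsD(1)[OF Fs] vV by auto
qed

text \<open>The preimage of the unit disc contains a neighbourhood of zero cut out by finitely many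
  seminorms. As each member of \<open>S\<close> is finite, these involve finitely many vectors
  altogether. A sum over them, in place of a maximum, passes directly through integrals and limits
  later on.\<close>

lemma pointwise_functional_bound:
  assumes "\<phi> \<in> carrier (dual_space operators pointwise_topology)"
  obtains A C where "finite A" "A \<subseteq> \<Union>S" "C \<ge> 0"
    "\<And>f. f \<in> carrier operators \<Longrightarrow> cmod (\<phi> f) \<le> C * (\<Sum>v\<in>A. n (f v))"
proof -
  interpret L: Module.module cplx operators by (rule operators_module)
  have lin: "linear_functional operators \<phi>" and cont: "continuous_map pointwise_topology euclidean \<phi>"
    using assms by (auto simp: dual_space_def)
  let ?qs = "{\<lambda>f. sup0 A (\<lambda>v. p (f v)) |A p. A \<in> S \<and> p \<in> P}"
  let ?U = "{f \<in> topspace pointwise_topology. \<phi> f \<in> ball 0 1}"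
  have smult0: "(0::complex) \<odot>\<^bsub>operators\<^esub> \<zero>\<^bsub>operators\<^esub> = \<zero>\<^bsub>operators\<^esub>"
    using L.smult_r_null[of 0] by simp
  have "\<phi> \<zero>\<^bsub>operators\<^esub> = 0"
    using lin operators_closed(3) smult0 unfolding linear_functional_def by (metis mult_zero_left)
  then have zU: "\<zero>\<^bsub>operators\<^esub> \<in> ?U" using operators_closed(3) by simp
  have opU: "openin (seminorm_topology operators ?qs) ?U"
    using openin_continuous_map_preimage[OF cont, of "ball 0 1"] by (simp add: endo_topology_def)
  have tri: "q (f \<ominus>\<^bsub>operators\<^esub> h) \<le> q (f \<ominus>\<^bsub>operators\<^esub> g) + q (g \<ominus>\<^bsub>operators\<^esub> h)"
    if "q \<in> ?qs" and fgh: "f \<in> carrier operators" "g \<in> carrier operators" "h \<in> carrier operators" for q f g h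
  proof -
    from that(1) obtain A p where q: "q = (\<lambda>f. sup0 A (\<lambda>v. p (f v)))" "A \<in> S" "p \<in> P" by blast
    show ?thesis unfolding q(1)
    proof (rule sup0_least)
      fix v assume v: "v \<in> A"
      have vV: "v \<in> carrier V" by (rule S_member(2)[OF q(2) v])
      note up = sup0_upper[OF S_member(1)[OF q(2)] v]
      have "p (f v \<ominus> h v) \<le> p (f v \<ominus> g v) + p (g v \<ominus> h v)"
        by (rule seminorm_diff_triangle[OF P_seminorm[OF q(3)]]) (use vV fgh operatorsD(1) in blast)+
      then show "p ((f \<ominus>\<^bsub>operators\<^esub> h) v)
        \<le> sup0 A (\<lambda>v. p ((f \<ominus>\<^bsub>operators\<^esub> g) v)) + sup0 A (\<lambda>v. p ((g \<ominus>\<^bsub>operators\<^esub> h) v))"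
        using up[of "\<lambda>v. p ((f \<ominus>\<^bsub>operators\<^esub> g) v)"] up[of "\<lambda>v. p ((g \<ominus>\<^bsub>operators\<^esub> h) v)"]
        by (simp add: operators_minus(2) vV fgh)
    qed (intro add_nonneg_nonneg sup0_nonneg S_member(1)[OF q(2)])
  qed
  have "\<exists>Q e. finite Q \<and> Q \<subseteq> ?qs \<and> e > 0 \<and>
      (\<forall>f\<in>carrier operators. (\<forall>q\<in>Q. q (f \<ominus>\<^bsub>operators\<^esub> \<zero>\<^bsub>operators\<^esub>) < e) \<longrightarrow> f \<in> ?U)"
    by (rule seminorm_topology_nhd[OF _ opU zU]) (rule tri)
  then obtain Q e where Q: "finite Q" "Q \<subseteq> ?qs" "e > 0" "\<forall>f\<in>carrier operators. (\<forall>q\<in>Q. q (f \<ominus>\<^bsub>operators\<^esub> \<zero>\<^bsub>operators\<^esub>) < e) \<longrightarrow> f \<in> ?U"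
    by (elim exE conjE)
  have "\<exists>A C. A \<in> S \<and> C > 0 \<and>
      (\<forall>f\<in>carrier operators. (\<forall>v\<in>A. C * n (f v) < e) \<longrightarrow> q f < e)" if qQ: "q \<in> Q" for q
  proof -
    obtain A p where q: "q = (\<lambda>f. sup0 A (\<lambda>v. p (f v)))" "A \<in> S" "p \<in> P"
      using Q(2) qQ by blast
    obtain C where C: "C > 0" "\<And>v. v \<in> carrier V \<Longrightarrow> p v \<le> C * n v"
      using P_le_norm[OF q(3)] by blast
    have "q f < e" if f: "f \<in> carrier operators" "\<forall>v\<in>A. C * n (f v) < e" for f
      unfolding q(1)
    proof (rule sup0_less[OF S_member(1)[OF q(2)] Q(3)])
      fix v assume v: "v \<in> A"
      show "p (f v) < e"
        using C(2)[OF operatorsD(1)[OF f(1) S_member(2)[OF q(2) v]]] f(2) v by fastforce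
    qed
    with q(2) C(1) show ?thesis by blast
  qed
  then obtain A C where AC: "\<And>q. q \<in> Q \<Longrightarrow> A q \<in> S" "\<And>q. q \<in> Q \<Longrightarrow> C q > (0::real)"
    "\<And>q f. q \<in> Q \<Longrightarrow> f \<in> carrier operators \<Longrightarrow> (\<forall>v\<in>A q. C q * n (f v) < e) \<Longrightarrow> q f < e"
    by metis
  define B where "B = (\<Union>q\<in>Q. A q)"
  \<comment> \<open>A common bound for all \<open>C q\<close>; the \<open>1\<close> keeps it
    positive when \<open>Q\<close> is empty.\<close>
  define K where "K = 1 + (\<Sum>q\<in>Q. C q)"
  have B: "finite B" "B \<subseteq> \<Union>S" "B \<subseteq> carrier V"
    using Q(1) AC(1) S_member by (auto simp: B_def)
  have K: "C q \<le> K" if "q \<in> Q" for q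
  proof -
    have "C q \<le> (\<Sum>q\<in>Q. C q)"
      by (rule member_le_sum) (use that Q(1) AC(2) in \<open>auto intro: less_imp_le\<close>)
    then show ?thesis by (simp add: K_def)
  qed
  have "0 \<le> (\<Sum>q\<in>Q. C q)"
    by (rule sum_nonneg) (rule less_imp_le[OF AC(2)])
  then have "K > 0" by (simp add: K_def)
  have nn: "0 \<le> n (f v)" if "f \<in> carrier operators" "v \<in> B" for f v
    using operatorsD(1)[OF that(1)] that(2) B(3) by auto
  have "cmod (\<phi> f) \<le> (1 / (e / K)) * (\<Sum>v\<in>B. n (f v))" if f: "f \<in> carrier operators" for f
  proof (rule homogeneous_bound[where V = operators and p = "\<lambda>f. cmod (\<phi> f)"])
    fix f assume f: "f \<in> carrier operators" and less: "(\<Sum>v\<in>B. n (f v)) < e / K"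
    have "f \<in> ?U"
    proof (rule Q(4)[rule_format, OF f])
      fix q assume q: "q \<in> Q"
      have "C q * n (f v) < e" if v: "v \<in> A q" for v
      proof -
        have vB: "v \<in> B" using v q by (auto simp: B_def)
        have "C q * n (f v) \<le> K * n (f v)" using K[OF q] nn[OF f vB] by (intro mult_right_mono)
        also have "\<dots> \<le> K * (\<Sum>v\<in>B. n (f v))"
          using \<open>K > 0\<close> nn[OF f] B(1) vB by (intro mult_left_mono member_le_sum) auto
        also have "\<dots> < e" using less \<open>K > 0\<close> by (simp add: field_simps)
        finally show ?thesis .
      qed
      then have "q f < e" using AC(3)[OF q f] by blast
      moreover have "f \<ominus>\<^bsub>operators\<^esub> \<zero>\<^bsub>operators\<^esub> = f"
        by (rule operators_eqI[OF operators_minus(1)])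
           (use f operators_closed(3) operatorsD(1)[OF f] in \<open>auto simp: operators_minus(2) minus_eq_smult\<close>)
      ultimately show "q (f \<ominus>\<^bsub>operators\<^esub> \<zero>\<^bsub>operators\<^esub>) < e" by simp
    qed
    then show "cmod (\<phi> f) < 1" by simp
  next
    fix c f assume f: "f \<in> carrier operators"
    show "cmod (\<phi> (c \<odot>\<^bsub>operators\<^esub> f)) = cmod c * cmod (\<phi> f)"
      using lin f by (simp add: linear_functional_def norm_mult)
    show "(\<Sum>v\<in>B. n ((c \<odot>\<^bsub>operators\<^esub> f) v)) = cmod c * (\<Sum>v\<in>B. n (f v))"
      unfolding sum_distrib_left
      by (rule sum.cong) (use B(3) operatorsD(1)[OF f] in auto)
  qed (use f Q(3) \<open>K > 0\<close> operators_closed(2) nn in \<open>auto intro: sum_nonneg\<close>)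
  then show thesis
    using B Q(3) \<open>K > 0\<close> by (intro that[of B "1 / (e / K)"]) auto
qed

end

section \<open>Operations on continuous curves and finite sums of operators\<close>

context banach_module
begin

lemma continuous_curve_cong:
  assumes "\<And>s. s \<ge> 0 \<Longrightarrow> G s = H s"
  shows "continuous_curve G \<longleftrightarrow> continuous_curve H"
  using assms by (simp add: continuous_curve_def)

lemma continuous_curve_add:
  assumes "continuous_curve G" "continuous_curve H"
  shows "continuous_curve (\<lambda>s. G s \<oplus> H s)"
  unfolding continuous_curve_def
proof (intro conjI allI impI)
  fix t e :: real assume "t \<ge> 0" "e > 0"
  obtain d1 where d1: "d1 > 0" "\<And>s. s \<ge> 0 \<Longrightarrow> \<bar>s - t\<bar> < d1 \<Longrightarrow> n (G s \<ominus> G t) < e / 2"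
    using continuous_curveD[OF assms(1) \<open>t \<ge> 0\<close>, of "e / 2"] \<open>e > 0\<close> by auto
  obtain d2 where d2: "d2 > 0" "\<And>s. s \<ge> 0 \<Longrightarrow> \<bar>s - t\<bar> < d2 \<Longrightarrow> n (H s \<ominus> H t) < e / 2"
    using continuous_curveD[OF assms(2) \<open>t \<ge> 0\<close>, of "e / 2"] \<open>e > 0\<close> by auto
  have "n ((G s \<oplus> H s) \<ominus> (G t \<oplus> H t)) < e" if "s \<ge> 0" "\<bar>s - t\<bar> < min d1 d2" for s
    using norm_add_diff[of "G s" "H s" "G t" "H t"] d1(2)[of s] d2(2)[of s] that \<open>t \<ge> 0\<close>
      continuous_curve_carrier[OF assms(1)] continuous_curve_carrier[OF assms(2)] by simp
  then show "\<exists>d>0. \<forall>s\<ge>0. \<bar>s - t\<bar> < d \<longrightarrow> n ((G s \<oplus> H s) \<ominus> (G t \<oplus> H t)) < e"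
    using d1(1) d2(1) by (intro exI[of _ "min d1 d2"]) simp
qed (use assms continuous_curve_carrier in auto)

lemma continuous_curve_smult:
  assumes "continuous_curve G" and c: "continuous_on {0..} c"
  shows "continuous_curve (\<lambda>s. c s \<odot> G s)"
  unfolding continuous_curve_def
proof (intro conjI allI impI)
  fix t e :: real assume "t \<ge> 0" "e > 0"
  note car = continuous_curve_carrier[OF assms(1)]
  have nG: "0 \<le> n (G t)" using car[OF \<open>t \<ge> 0\<close>] by simp
  \<comment> \<open>The difference is split at \<open>c s \<odot> G t\<close>. The
    \<open>min 1\<close> in \<open>e2\<close> ensures
    \<open>cmod (c s) \<le> cmod (c t) + 1\<close>, the factor anticipated in
    \<open>e1\<close>.\<close>
  define e1 where "e1 = e / 2 / (cmod (c t) + 1)"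
  define e2 where "e2 = min 1 (e / 2 / (n (G t) + 1))"
  have pos: "cmod (c t) + 1 > 0" by (rule add_nonneg_pos) auto
  have "e1 > 0" "e2 > 0" using \<open>e > 0\<close> nG pos by (auto simp: e1_def e2_def)
  obtain d1 where d1: "d1 > 0" "\<And>s. s \<ge> 0 \<Longrightarrow> \<bar>s - t\<bar> < d1 \<Longrightarrow> n (G s \<ominus> G t) < e1"
    using continuous_curveD[OF assms(1) \<open>t \<ge> 0\<close> \<open>e1 > 0\<close>] by auto
  obtain d2 where d2: "d2 > 0" "\<And>s. s \<ge> 0 \<Longrightarrow> \<bar>s - t\<bar> < d2 \<Longrightarrow> cmod (c s - c t) < e2"
  proof -
    have "\<exists>d>0. \<forall>s\<in>{0..}. dist s t < d \<longrightarrow> dist (c s) (c t) < e2"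
      using c[unfolded continuous_on_iff, rule_format, of t e2] \<open>t \<ge> 0\<close> \<open>e2 > 0\<close> by simp
    then show thesis using that by (auto simp: dist_norm)
  qed
  have "n (c s \<odot> G s \<ominus> c t \<odot> G t) < e" if s: "s \<ge> 0" "\<bar>s - t\<bar> < min d1 d2" for s
  proof -
    have Gst: "G s \<in> carrier V" "G t \<in> carrier V" using car s \<open>t \<ge> 0\<close> by auto
    have cs: "cmod (c s - c t) < e2" and gs: "n (G s \<ominus> G t) < e1" using d1(2) d2(2) s by auto
    have "cmod (c s) \<le> cmod (c t) + 1"
      using cs norm_triangle_ineq2[of "c s" "c t"] by (simp add: e2_def)
    then have "cmod (c s) * n (G s \<ominus> G t) \<le> (cmod (c t) + 1) * e1"
      using gs Gst by (intro mult_mono) auto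
    also have "(cmod (c t) + 1) * e1 = e / 2"
      unfolding e1_def using pos by (metis nonzero_eq_divide_eq less_irrefl mult.commute)
    finally have 1: "n (c s \<odot> G s \<ominus> c s \<odot> G t) \<le> e / 2"
      using Gst by (simp add: norm_smult_diff)
    have "c s \<odot> G t \<ominus> c t \<odot> G t = (c s - c t) \<odot> G t"
      using Gst smult_add_left[of "G t" "c s" "- c t"] by (simp add: minus_eq_smult smult_smult)
    then have "n (c s \<odot> G t \<ominus> c t \<odot> G t) = cmod (c s - c t) * n (G t)" using Gst by simp
    also have "\<dots> \<le> e / 2 / (n (G t) + 1) * n (G t)"
      using cs nG by (intro mult_right_mono) (auto simp: e2_def)
    also have "\<dots> < e / 2 / (n (G t) + 1) * (n (G t) + 1)"
      using \<open>e > 0\<close> nG by (intro mult_strict_left_mono) auto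
    also have "\<dots> = e / 2" using nG by (metis add_nonneg_pos less_irrefl nonzero_eq_divide_eq zero_less_one)
    finally show ?thesis
      using 1 norm_diff_triangle[of "c s \<odot> G s" "c s \<odot> G t" "c t \<odot> G t"] Gst by simp
  qed
  then show "\<exists>d>0. \<forall>s\<ge>0. \<bar>s - t\<bar> < d \<longrightarrow> n (c s \<odot> G s \<ominus> c t \<odot> G t) < e"
    using d1(1) d2(1) by (intro exI[of _ "min d1 d2"]) simp
qed (use assms continuous_curve_carrier in auto)

text \<open>One operator with two readings: evaluated at a vector it is a sum in \<open>V\<close>,
  and under a linear functional it is a sum of complex numbers. The Riemann sums \<open>R\<close> of
  the weak integral are obtained from it.\<close>

lemma operator_finsum:
  assumes "\<And>i. H i \<in> carrier operators"
  shows "\<exists>f\<in>carrier operators. (\<forall>v\<in>carrier V. f v = (\<Oplus>i\<in>{..<k::nat}. H i v)) \<and>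
    (\<forall>\<phi>. linear_functional operators \<phi> \<longrightarrow> \<phi> f = (\<Sum>i<k. \<phi> (H i)))"
proof (induction k)
  case 0
  have "\<phi> \<zero>\<^bsub>operators\<^esub> = 0" if "linear_functional operators \<phi>" for \<phi>
  proof -
    interpret L: Module.module cplx operators by (rule operators_module)
    have "\<phi> (0 \<odot>\<^bsub>operators\<^esub> \<zero>\<^bsub>operators\<^esub>) = 0 * \<phi> \<zero>\<^bsub>operators\<^esub>"
      using that operators_closed(3) unfolding linear_functional_def by blast
    then show ?thesis using L.smult_r_null[of 0] by simp
  qed
  then show ?case using operators_closed(3) by (intro bexI[of _ "\<zero>\<^bsub>operators\<^esub>"]) auto
next
  case (Suc k)
  then obtain f where f: "f \<in> carrier operators" "\<forall>v\<in>carrier V. f v = (\<Oplus>i\<in>{..<k}. H i v)"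
    "\<forall>\<phi>. linear_functional operators \<phi> \<longrightarrow> \<phi> f = (\<Sum>i<k. \<phi> (H i))" by blast
  show ?case
  proof (intro bexI[of _ "f \<oplus>\<^bsub>operators\<^esub> H k"] conjI ballI allI impI)
    fix v assume v: "v \<in> carrier V"
    show "(f \<oplus>\<^bsub>operators\<^esub> H k) v = (\<Oplus>i\<in>{..<Suc k}. H i v)"
      using f(2) v operatorsD(1)[OF assms v] by (simp add: finsum_lessThan_Suc Pi_def)
  next
    fix \<phi> assume "linear_functional operators \<phi>"
    then show "\<phi> (f \<oplus>\<^bsub>operators\<^esub> H k) = (\<Sum>i<Suc k. \<phi> (H i))"
      using f(1,3) assms by (simp add: linear_functional_def)
  qed (rule operators_closed(1)[OF f(1) assms])
qed

lemma limit_unique: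
  assumes "F \<noteq> bot" "\<And>a. R a \<in> carrier V" "u \<in> carrier V" "w \<in> carrier V"
    and "((\<lambda>a. n (R a \<ominus> u)) \<longlongrightarrow> 0) F" "((\<lambda>a. n (R a \<ominus> w)) \<longlongrightarrow> 0) F"
  shows "u = w"
proof (rule eq_if_norm_diff_le[OF assms(3,4)])
  have "n (u \<ominus> w) \<le> n (R a \<ominus> u) + n (R a \<ominus> w)" for a
    using norm_diff_triangle[of u "R a" w] norm_diff_commute[of u "R a"] assms(2-4) by simp
  then have "\<forall>\<^sub>F a in F. n (u \<ominus> w) \<le> n (R a \<ominus> u) + n (R a \<ominus> w)"
    by (intro always_eventually allI)
  with tendsto_add[OF assms(5,6)] have "n (u \<ominus> w) \<le> 0 + 0"
    using assms(1) by (rule tendsto_lowerbound)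
  then show "n (u \<ominus> w) \<le> 0" by simp
qed

end

section \<open>Weak integrals of operator-valued maps\<close>

context pointwise_operators
begin

text \<open>Taking all vectors with a continuous orbit avoids any description of the elements of the
  span: linearity of each \<open>F s\<close> makes \<open>D\<close> a submodule, the span of
  \<open>\<Union>S\<close> is contained in it by minimality, and totality of
  \<open>\<Union>S\<close> gives density.\<close>

lemma continuous_domain_dense:
  assumes F: "continuous_map Rplus pointwise_topology F"
  defines "D \<equiv> {v \<in> carrier V. continuous_curve (\<lambda>s. F s v)}"
  shows "submodule D cplx V" and "\<Union>S \<subseteq> D"
    and "\<And>v e. v \<in> carrier V \<Longrightarrow> e > 0 \<Longrightarrow> \<exists>d\<in>D. n (d \<ominus> v) < e"
proof -
  have Fs: "F s \<in> carrier operators" if "s \<ge> 0" for s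
    using continuous_map_image_subset_topspace[OF F] that by auto
  have add: "u \<oplus> v \<in> D" if "u \<in> D" "v \<in> D" for u v
  proof -
    have uv: "u \<in> carrier V" "v \<in> carrier V" using that by (auto simp: D_def)
    have "continuous_curve (\<lambda>s. F s (u \<oplus> v)) \<longleftrightarrow> continuous_curve (\<lambda>s. F s u \<oplus> F s v)"
      by (rule continuous_curve_cong) (rule operatorsD(2)[OF Fs uv])
    then show ?thesis using that continuous_curve_add uv by (simp add: D_def)
  qed
  have smult: "c \<odot> v \<in> D" if "v \<in> D" for c v
  proof -
    have v: "v \<in> carrier V" using that by (simp add: D_def)
    have "continuous_curve (\<lambda>s. F s (c \<odot> v)) \<longleftrightarrow> continuous_curve (\<lambda>s. c \<odot> F s v)"
      by (rule continuous_curve_cong) (rule operatorsD(3)[OF Fs v])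
    then show ?thesis using that continuous_curve_smult[of "\<lambda>s. F s v" "\<lambda>s. c"] v by (simp add: D_def)
  qed
  show SD: "\<Union>S \<subseteq> D"
    using pointwise_continuous_curve[OF F] S_member(2) by (auto simp: D_def)
  have "continuous_curve (\<lambda>s. F s \<zero>) \<longleftrightarrow> continuous_curve (\<lambda>s. \<zero>)"
    by (rule continuous_curve_cong) (rule linear_endo_zero[OF operators_linear[OF Fs]])
  moreover have "continuous_curve (\<lambda>s. \<zero>)"
    unfolding continuous_curve_def using zero_less_one by auto
  ultimately have zero: "\<zero> \<in> D" by (simp add: D_def)
  have sub: "D \<subseteq> carrier V" by (auto simp: D_def)
  show D: "submodule D cplx V"
    using sub zero _ add smult
  proof (rule submoduleI)
    show "\<ominus> a \<in> D" if "a \<in> D" for a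
      using smult[OF that, of "- 1"] that sub by (simp add: uminus_eq_smult subset_iff)
  qed
  have span: "linear_span V (\<Union>S) \<subseteq> D"
    unfolding linear_span_def using D SD by blast
  show "\<exists>d\<in>D. n (d \<ominus> v) < e" if v: "v \<in> carrier V" and "e > 0" for v e
  proof -
    let ?B = "{w \<in> carrier V. n (w \<ominus> v) < e}"
    have "openin norm_topology ?B" by (rule openin_seminorm_ball) (use that in auto)
    moreover have "v \<in> norm_topology closure_of (linear_span V (\<Union>S))"
      using S_total v unfolding total_in_def by simp
    moreover have "v \<in> ?B" using that by simp
    ultimately obtain d where "d \<in> linear_span V (\<Union>S)" "d \<in> ?B"
      unfolding in_closure_of by meson
    with span show ?thesis by auto
  qed
qed

lemma scalarly_L1_of_upper_integral:
  assumes F: "continuous_map Rplus pointwise_topology F" and ext: "F \<in> extensional {0..}"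
    and "l > 0"
    and upper: "upper_integral Rplus (lebesgue_on {0..})
      (\<lambda>s. ennreal (exp (- l * s) * op_norm V n (F s))) < \<infinity>"
  shows "F \<in> scalarly_L1 (exp_measure l) operators pointwise_topology"
proof -
  let ?M = "lebesgue_on {0..} :: real measure"
  define c where "c s = complex_of_real (exp (- l * s))" for s
  have cont_c: "continuous_on {0..} c"
    unfolding c_def by (intro continuous_intros)
  have norm_c: "cmod (c s) = exp (- l * s)" for s by (simp add: c_def)
  have Fs: "F s \<in> carrier operators" if "s \<ge> 0" for s
    using continuous_map_image_subset_topspace[OF F] that by auto
  \<comment> \<open>A finite infimum yields one majorant with finite integral; its integral
    \<open>J\<close> will bound the norm of the weak integral.\<close>
  obtain g where g: "\<And>s. s \<ge> 0 \<Longrightarrow> ennreal (exp (- l * s) * op_norm V n (F s)) \<le> g s"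
    "(\<integral>\<^sup>+ s. g s \<partial>?M) < \<infinity>"
    using upper unfolding upper_integral_def Inf_less_iff by auto
  define J where "J = enn2real (\<integral>\<^sup>+ s. g s \<partial>?M)"
  have "J \<ge> 0" by (simp add: J_def)
  define D where "D = {v \<in> carrier V. continuous_curve (\<lambda>s. F s v)}"
  note D = continuous_domain_dense[OF F, folded D_def]
  define G where "G v s = c s \<odot> F s v" for v s
  have G_car: "G v s \<in> carrier V" if "v \<in> carrier V" "s \<ge> 0" for v s
    using operatorsD(1)[OF Fs] that by (simp add: G_def)
  have G_cont: "continuous_curve (G v)" if "v \<in> D" for v
    unfolding G_def using continuous_curve_smult[OF _ cont_c] that by (simp add: D_def)
  have G_int: "integrable ?M (\<lambda>s. n (G v s))" "(\<integral>s. n (G v s) \<partial>?M) \<le> J * n v" if v: "v \<in> D" for v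
  proof -
    have vV: "v \<in> carrier V" using v by (simp add: D_def)
    have le: "n (G v s) \<le> n v * (exp (- l * s) * op_norm V n (F s))" if "s \<ge> 0" for s
      using mult_left_mono[OF op_norm_bound[OF Fs[OF that] vV], of "cmod (c s)"]
        operatorsD(1)[OF Fs[OF that] vV] by (simp add: G_def norm_c mult_ac)
    \<comment> \<open>Here \<open>K\<close> is \<open>n v\<close>, which makes the bound on the
      integral linear in \<open>n v\<close> with a constant independent of \<open>v\<close>.\<close>
    note * = integrable_majorized[OF continuous_on_norm_curve[OF G_cont[OF v]] norm_nonneg[OF vV]
        norm_nonneg[OF G_car[OF vV]] le g]
    show "integrable ?M (\<lambda>s. n (G v s))" by (rule *(1))
    show "(\<integral>s. n (G v s) \<partial>?M) \<le> J * n v" using *(2) by (simp add: J_def mult.commute)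
  qed
  \<comment> \<open>The Riemann sum of \<open>c s \<odot> F s\<close> as a single operator, for each
    pair \<open>a\<close> of length and mesh. Its two descriptions hold for every vector and every
    linear functional at once.\<close>
  have "\<exists>f\<in>carrier operators. (\<forall>v\<in>carrier V. f v = curve_sum (G v) a) \<and>
      (\<forall>\<phi>. linear_functional operators \<phi> \<longrightarrow> \<phi> f = riemann_sum (\<lambda>s. c s * \<phi> (F s)) a)" for a
  proof (cases a)
    case (Pair N k)
    define H where "H i = (c (real i / 2 ^ k) / 2 ^ k) \<odot>\<^bsub>operators\<^esub> F (real i / 2 ^ k)" for i :: nat
    have Hi: "H i \<in> carrier operators" for i
      unfolding H_def by (intro operators_closed(2) Fs) simp
    obtain f where f: "f \<in> carrier operators" "\<forall>v\<in>carrier V. f v = (\<Oplus>i\<in>{..<N * 2 ^ k}. H i v)"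
      "\<forall>\<phi>. linear_functional operators \<phi> \<longrightarrow> \<phi> f = (\<Sum>i<N * 2 ^ k. \<phi> (H i))"
      using operator_finsum[of H "N * 2 ^ k", OF Hi] by blast
    have "f v = curve_sum (G v) a" if v: "v \<in> carrier V" for v
    proof -
      have "H i v = (1 / 2 ^ k) \<odot> G v (real i / 2 ^ k)" for i
        using v operatorsD(1)[OF Fs v, of "real i / 2 ^ k"] by (simp add: H_def G_def smult_smult)
      then show ?thesis using f(2) v by (simp add: curve_sum_def Pair)
    qed
    moreover have "\<phi> f = riemann_sum (\<lambda>s. c s * \<phi> (F s)) a" if \<phi>: "linear_functional operators \<phi>" for \<phi>
    proof -
      have "\<phi> (H i) = (c (real i / 2 ^ k) * \<phi> (F (real i / 2 ^ k))) /\<^sub>R 2 ^ k" for i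
        using \<phi> Fs[of "real i / 2 ^ k"]
        by (simp add: H_def linear_functional_def scaleR_conv_of_real divide_inverse)
      then show ?thesis using f(3)[rule_format, OF \<phi>] by (simp add: riemann_sum_def Pair)
    qed
    ultimately show ?thesis using f(1) by blast
  qed
  then obtain R where R: "\<And>a. R a \<in> carrier operators"
    "\<And>a v. v \<in> carrier V \<Longrightarrow> R a v = curve_sum (G v) a"
    "\<And>a \<phi>. linear_functional operators \<phi> \<Longrightarrow> \<phi> (R a) = riemann_sum (\<lambda>s. c s * \<phi> (F s)) a"
    by metis
  have DV: "v \<in> carrier V" if "v \<in> D" for v using that by (simp add: D_def)
  have "\<exists>u. u \<in> carrier V \<and> ((\<lambda>a. n (R a v \<ominus> u)) \<longlongrightarrow> 0) riemann_filter \<and> n u \<le> J * n v"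
    if v: "v \<in> D" for v
  proof -
    obtain u where "u \<in> carrier V" "((\<lambda>a. n (curve_sum (G v) a \<ominus> u)) \<longlongrightarrow> 0) riemann_filter"
      "n u \<le> (\<integral>s. n (G v s) \<partial>?M)"
      using curve_sum_convergent[OF G_cont[OF v] G_int(1)[OF v]] by blast
    then show ?thesis using G_int(2)[OF v] by (intro exI[of _ u]) (simp add: R(2)[OF DV[OF v]])
  qed
  then obtain w0 where w0: "\<And>v. v \<in> D \<Longrightarrow> w0 v \<in> carrier V"
    "\<And>v. v \<in> D \<Longrightarrow> ((\<lambda>a. n (R a v \<ominus> w0 v)) \<longlongrightarrow> 0) riemann_filter"
    "\<And>v. v \<in> D \<Longrightarrow> n (w0 v) \<le> J * n v"
    by metis
  note RD = operatorsD[OF R(1)]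
  have w0_add: "w0 (u \<oplus> v) = w0 u \<oplus> w0 v" if uv: "u \<in> D" "v \<in> D" for u v
  proof (rule limit_unique[OF riemann_filter_neq_bot])
    have uvD: "u \<oplus> v \<in> D" using submoduleE(5)[OF D(1)] uv by blast
    show "R a (u \<oplus> v) \<in> carrier V" for a using RD(1) DV[OF uvD] .
    show "((\<lambda>a. n (R a (u \<oplus> v) \<ominus> w0 (u \<oplus> v))) \<longlongrightarrow> 0) riemann_filter" by (rule w0(2)[OF uvD])
    show "w0 (u \<oplus> v) \<in> carrier V" by (rule w0(1)[OF uvD])
    show "w0 u \<oplus> w0 v \<in> carrier V" using w0(1) uv by auto
    show "((\<lambda>a. n (R a (u \<oplus> v) \<ominus> (w0 u \<oplus> w0 v))) \<longlongrightarrow> 0) riemann_filter"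
    proof (rule Lim_null_comparison)
      show "((\<lambda>a. n (R a u \<ominus> w0 u) + n (R a v \<ominus> w0 v)) \<longlongrightarrow> 0) riemann_filter"
        using tendsto_add[OF w0(2)[OF uv(1)] w0(2)[OF uv(2)]] by simp
      have "norm (n (R a (u \<oplus> v) \<ominus> (w0 u \<oplus> w0 v))) \<le> n (R a u \<ominus> w0 u) + n (R a v \<ominus> w0 v)" for a
        using norm_add_diff[OF RD(1)[OF DV[OF uv(1)]] RD(1)[OF DV[OF uv(2)]] w0(1)[OF uv(1)] w0(1)[OF uv(2)]]
          RD(1)[OF DV[OF uv(1)]] RD(1)[OF DV[OF uv(2)]] w0(1)[OF uv(1)] w0(1)[OF uv(2)]
          RD(2)[OF DV[OF uv(1)] DV[OF uv(2)]] by simp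
      then show "\<forall>\<^sub>F a in riemann_filter.
          norm (n (R a (u \<oplus> v) \<ominus> (w0 u \<oplus> w0 v))) \<le> n (R a u \<ominus> w0 u) + n (R a v \<ominus> w0 v)"
        by (intro always_eventually allI)
    qed
  qed
  have w0_smult: "w0 (b \<odot> v) = b \<odot> w0 v" if v: "v \<in> D" for b v
  proof (rule limit_unique[OF riemann_filter_neq_bot])
    have bvD: "b \<odot> v \<in> D" using submoduleE(4)[OF D(1)] v by simp
    show "R a (b \<odot> v) \<in> carrier V" for a using RD(1) DV[OF bvD] .
    show "((\<lambda>a. n (R a (b \<odot> v) \<ominus> w0 (b \<odot> v))) \<longlongrightarrow> 0) riemann_filter" by (rule w0(2)[OF bvD])
    show "w0 (b \<odot> v) \<in> carrier V" by (rule w0(1)[OF bvD])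
    show "b \<odot> w0 v \<in> carrier V" using w0(1)[OF v] by auto
    have "n (R a (b \<odot> v) \<ominus> b \<odot> w0 v) = cmod b * n (R a v \<ominus> w0 v)" for a
      using norm_smult_diff[OF RD(1)[OF DV[OF v]] w0(1)[OF v]] RD(3)[OF DV[OF v]] by simp
    then show "((\<lambda>a. n (R a (b \<odot> v) \<ominus> b \<odot> w0 v)) \<longlongrightarrow> 0) riemann_filter"
      using tendsto_mult_left[OF w0(2)[OF v], of "cmod b"] by simp
  qed
  \<comment> \<open>Uniqueness of limits has made \<open>w0\<close> linear on the dense
    \<open>D\<close>, and \<open>J\<close> bounds it there, so it extends.\<close>
  obtain w where w: "w \<in> carrier operators" "\<And>v. v \<in> D \<Longrightarrow> w v = w0 v"
    using bounded_extension[OF D(1) D(3) w0(1) w0_add w0_smult \<open>J \<ge> 0\<close> w0(3)] by blast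
  have main: "integrable ?M (\<lambda>s. c s * \<phi> (F s)) \<and> \<phi> w = (\<integral>s. c s * \<phi> (F s) \<partial>?M) \<and>
      (\<lambda>s. \<phi> (F s)) \<in> borel_measurable ?M"
    if \<phi>: "\<phi> \<in> carrier (dual_space operators pointwise_topology)" for \<phi>
  proof -
    have lin: "linear_functional operators \<phi>" and "continuous_map pointwise_topology euclidean \<phi>"
      using \<phi> by (auto simp: dual_space_def)
    then have "continuous_map Rplus euclidean (\<phi> \<circ> F)"
      using continuous_map_compose[OF F] by blast
    then have cont: "continuous_on {0..} (\<lambda>s. \<phi> (F s))"
      by (simp add: o_def)
    have meas: "(\<lambda>s. \<phi> (F s)) \<in> borel_measurable ?M"
      by (rule continuous_imp_measurable_on_sets_lebesgue[OF cont]) auto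
    have cont': "continuous_on {0..} (\<lambda>s. c s * \<phi> (F s))"
      by (intro continuous_on_mult cont cont_c)
    have meas': "(\<lambda>s. c s * \<phi> (F s)) \<in> borel_measurable ?M"
      by (rule continuous_imp_measurable_on_sets_lebesgue[OF cont']) auto
    obtain A C where A: "finite A" "A \<subseteq> \<Union>S" "C \<ge> 0"
      "\<And>f. f \<in> carrier operators \<Longrightarrow> cmod (\<phi> f) \<le> C * (\<Sum>v\<in>A. n (f v))"
      using pointwise_functional_bound[OF \<phi>] by blast
    have AD: "v \<in> D" if "v \<in> A" for v using that A(2) D(2) by blast
    \<comment> \<open>The dominating function for \<open>c s * \<phi> (F s)\<close>: a finite sum of
      the integrable \<open>n (G v s)\<close>, available since the vectors in the bound on \<phi>
      lie in \<open>D\<close>.\<close>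
    have bound_int: "integrable ?M (\<lambda>s. C * (\<Sum>v\<in>A. n (G v s)))"
      by (intro integrable_mult_right Bochner_Integration.integrable_sum G_int(1) AD)
    have int: "integrable ?M (\<lambda>s. c s * \<phi> (F s))"
    proof (rule Bochner_Integration.integrable_bound[OF bound_int meas'], rule AE_I2)
      fix s assume "s \<in> space ?M"
      then have s: "s \<ge> 0" by simp
      have sum_eq: "(\<Sum>v\<in>A. n (G v s)) = cmod (c s) * (\<Sum>v\<in>A. n (F s v))"
        unfolding sum_distrib_left
        by (rule sum.cong) (use operatorsD(1)[OF Fs[OF s]] DV AD in \<open>auto simp: G_def\<close>)
      have "norm (c s * \<phi> (F s)) \<le> cmod (c s) * (C * (\<Sum>v\<in>A. n (F s v)))"
        unfolding norm_mult by (intro mult_left_mono A(4) Fs s) simp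
      also have "\<dots> = C * (\<Sum>v\<in>A. n (G v s))" unfolding sum_eq by simp
      also have "\<dots> \<le> norm \<dots>" by simp
      finally show "norm (c s * \<phi> (F s)) \<le> norm (C * (\<Sum>v\<in>A. n (G v s)))" .
    qed
    have lim1: "((\<lambda>a. \<phi> (R a)) \<longlongrightarrow> (\<integral>s. c s * \<phi> (F s) \<partial>?M)) riemann_filter"
      using riemann_sum_tendsto[OF cont' int] R(3)[OF lin] by simp
    \<comment> \<open>The bound on \<phi> is applied to the operator \<open>R a - w\<close>; it
      evaluates only at vectors of \<open>A\<close>, where \<open>w\<close> agrees with the
      pointwise limit \<open>w0\<close>.\<close>
    have lim2: "((\<lambda>a. \<phi> (R a)) \<longlongrightarrow> \<phi> w) riemann_filter"
    proof (rule LIM_zero_cancel, rule Lim_null_comparison)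
      have "((\<lambda>a. C * (\<Sum>v\<in>A. n (R a v \<ominus> w0 v))) \<longlongrightarrow> C * (\<Sum>v\<in>A. 0)) riemann_filter"
        by (intro tendsto_mult_left tendsto_sum w0(2) AD)
      then show "((\<lambda>a. C * (\<Sum>v\<in>A. n (R a v \<ominus> w0 v))) \<longlongrightarrow> 0) riemann_filter" by simp
      have "norm (\<phi> (R a) - \<phi> w) \<le> C * (\<Sum>v\<in>A. n (R a v \<ominus> w0 v))" for a
      proof -
        have "\<phi> (R a \<ominus>\<^bsub>operators\<^esub> w) = \<phi> (R a) - \<phi> w"
          using lin R(1) w(1) operators_closed(2)[OF w(1)]
          by (simp add: operators_minus(3) linear_functional_def)
        moreover have "(\<Sum>v\<in>A. n ((R a \<ominus>\<^bsub>operators\<^esub> w) v)) = (\<Sum>v\<in>A. n (R a v \<ominus> w0 v))"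
          by (rule sum.cong) (simp_all add: operators_minus(2)[OF R(1) w(1)] DV AD w(2))
        ultimately show ?thesis
          using A(4)[OF operators_minus(1)[OF R(1) w(1)], of a] by simp
      qed
      then show "\<forall>\<^sub>F a in riemann_filter. norm (\<phi> (R a) - \<phi> w) \<le> C * (\<Sum>v\<in>A. n (R a v \<ominus> w0 v))"
        by (intro always_eventually allI)
    qed
    show ?thesis
      using tendsto_unique[OF riemann_filter_neq_bot lim2 lim1] int meas by blast
  qed
  have exp_meas: "(\<lambda>s. exp (- l * s)) \<in> borel_measurable ?M"
    by (rule continuous_imp_measurable_on_sets_lebesgue) (auto intro!: continuous_intros)
  have scale: "exp (- (l * s)) *\<^sub>R z = c s * z" for s z
    by (simp add: c_def scaleR_conv_of_real)
  \<comment> \<open>The weight \<open>c\<close> moves from the integrand into the measure. The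
    density rules ask for measurability of the unweighted \<open>\<phi> (F s)\<close>, which
    \<open>main\<close> records for this purpose.\<close>
  have dens: "integrable (exp_measure l) (\<lambda>s. \<phi> (F s))"
    "\<phi> w = (\<integral>s. \<phi> (F s) \<partial>exp_measure l)"
    if "\<phi> \<in> carrier (dual_space operators pointwise_topology)" for \<phi>
  proof -
    note m = main[OF that]
    show "integrable (exp_measure l) (\<lambda>s. \<phi> (F s))"
      unfolding exp_measure_def using m exp_meas
      by (subst integrable_density) (simp_all add: scale)
    show "\<phi> w = (\<integral>s. \<phi> (F s) \<partial>exp_measure l)"
      unfolding exp_measure_def using m exp_meas
      by (subst integral_density) (simp_all add: scale)
  qed
  have "F \<in> space (exp_measure l) \<rightarrow>\<^sub>E carrier operators"
    using Fs ext by (auto simp: exp_measure_def PiE_iff)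
  with dens w(1) show ?thesis
    unfolding scalarly_L1_def by blast
qed

end

section \<open>Application to the stalks of the bundle\<close>

lemma upper_integral_exp_bounded:
  fixes m :: "real \<Rightarrow> real"
  assumes "l > 0" and m: "\<And>s. s \<ge> 0 \<Longrightarrow> m s \<le> K"
  shows "upper_integral Rplus (lebesgue_on {0..}) (\<lambda>s. ennreal (exp (- l * s) * m s)) < \<infinity>"
proof -
  \<comment> \<open>A continuous, hence lower semicontinuous, majorant of finite integral;
    \<open>\<bar>K\<bar>\<close> keeps it nonnegative whatever the sign of the bound.\<close>
  let ?M = "lebesgue_on {0..} :: real measure" and ?g = "\<lambda>s. ennreal (exp (- l * s) * \<bar>K\<bar>)"
  have cont: "continuous_on {0..} ?g"
    by (intro continuous_on_ennreal continuous_intros)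
  have "lower_semicontinuous Rplus ?g"
    unfolding lower_semicontinuous_def
  proof
    fix c :: ennreal
    have "openin Rplus ({0..} \<inter> ?g -` {c<..})"
      by (rule continuous_openin_preimage_gen[OF cont]) simp
    moreover have "{y \<in> topspace Rplus. c < ?g y} = {0..} \<inter> ?g -` {c<..}" by auto
    ultimately show "openin Rplus {y \<in> topspace Rplus. c < ?g y}" by simp
  qed
  moreover have "ennreal (exp (- l * s) * m s) \<le> ?g s" if "s \<in> topspace Rplus" for s
    using m[of s] that by (intro ennreal_leI mult_left_mono) auto
  ultimately have "upper_integral Rplus ?M (\<lambda>s. ennreal (exp (- l * s) * m s)) \<le> (\<integral>\<^sup>+ s. ?g s \<partial>?M)"
    unfolding upper_integral_def by (intro Inf_lower) blast
  also have "\<dots> < \<infinity>"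
  proof -
    have "(\<lambda>s. exp (- l * s)) absolutely_integrable_on {0..}"
      by (rule nonnegative_absolutely_integrable_1[OF integrable_on_exp_minus_to_infinity[OF assms(1)]]) simp
    then have "integrable ?M (\<lambda>s. exp (- l * s) * \<bar>K\<bar>)"
      by (intro integrable_mult_left) (simp add: integrable_restrict_space set_integrable_def)
    then have "(\<integral>\<^sup>+ s. ennreal (norm (exp (- l * s) * \<bar>K\<bar>)) \<partial>?M) < \<infinity>"
      by (simp only: integrable_iff_bounded)
    moreover have "norm (exp (- l * s) * \<bar>K\<bar>) = exp (- l * s) * \<bar>K\<bar>" for s
      by (simp add: abs_mult)
    ultimately show ?thesis by (simp only:)
  qed
  finally show ?thesis .
qed

text \<open>The topology of a stalk is described twice, by the bundle through the
  \<open>nu V j\<close> and by the Banach norm; equating the two descriptions gives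
  \<open>P_topology\<close>.\<close>

lemma pointwise_operators_stalk:
  assumes "Theta_structure V W Rplus \<Theta> \<E>"
    and x: "x \<in> topspace (base_space V)"
    and "reflexive_banach (stalk V x) (stalk_topology V x) n"
    and "S_family V \<Theta> \<E> x \<subseteq> Fpow (carrier (stalk V x))"
  shows "pointwise_operators (stalk V x) n (nu V ` idx V) (S_family V \<Theta> \<E> x)"
    and "stalk_topology V x = seminorm_topology (stalk V x) {n}"
proof -
  have banach: "banach_norm (stalk V x) (stalk_topology V x) n"
    using assms(3) by (simp add: reflexive_banach_def)
  then show top: "stalk_topology V x = seminorm_topology (stalk V x) {n}"
    by (simp add: banach_norm_def)
  have "omega_bundle V" and tot: "total_in (stalk V x) (stalk_topology V x) (\<Union>(S_family V \<Theta> \<E> x))"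
    using assms(1) x by (auto simp: Theta_structure_def)
  then have nu: "idx V \<noteq> {}" "\<forall>j\<in>idx V. seminorm (stalk V x) (nu V j)"
    "\<forall>i\<in>idx V. \<forall>j\<in>idx V. \<exists>k\<in>idx V. \<forall>e\<in>carrier (stalk V x). nu V i e \<le> nu V k e \<and> nu V j e \<le> nu V k e"
    "stalk_topology V x = seminorm_topology (stalk V x) (nu V ` idx V)"
    using x unfolding omega_bundle_def by auto
  interpret banach_module "stalk V x" n
  proof (rule banach_module.intro)
    show "cvector_space (stalk V x)" using banach by (simp add: banach_norm_def)
    show "banach_module_axioms (stalk V x) n"
      using banach unfolding banach_norm_def banach_module_axioms_def by blast
  qed
  show "pointwise_operators (stalk V x) n (nu V ` idx V) (S_family V \<Theta> \<E> x)"
    by unfold_locales (use nu tot assms(4) top in auto)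
qed

lemma stalk_scalarly_L1:
  assumes "Theta_structure V W Rplus \<Theta> \<E>"
    and "x \<in> topspace (base_space V)"
    and "reflexive_banach (stalk V x) (stalk_topology V x) n"
    and "S_family V \<Theta> \<E> x \<subseteq> Fpow (carrier (stalk V x))"
    and F: "F \<in> carrier (cont_maps V \<Theta> \<E> Rplus x)" and "l > 0"
    and upper: "upper_integral Rplus (lebesgue_on {0..})
      (\<lambda>s. ennreal (exp (- l * s) * op_norm (stalk V x) n (F s))) < \<infinity>"
  shows "F \<in> scalarly_L1 (exp_measure l) (LE V x) (LS_topology V \<Theta> \<E> x)"
proof -
  interpret pointwise_operators "stalk V x" n "nu V ` idx V" "S_family V \<Theta> \<E> x"
    by (rule pointwise_operators_stalk(1)[OF assms(1-4)])
  note top = pointwise_operators_stalk(2)[OF assms(1-4)]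
  have LS: "LS_topology V \<Theta> \<E> x = pointwise_topology"
    by (simp add: LS_topology_def top)
  have "F \<in> extensional {0..}" "continuous_map Rplus pointwise_topology F"
    using F by (simp_all add: cont_maps_def LS)
  then show ?thesis
    \<comment> \<open>Once the stalk topology is rewritten as the norm topology,
      \<open>LE V x\<close> is the module \<open>operators\<close> of the locale.\<close>
    unfolding top LS using assms(6) upper by (intro scalarly_L1_of_upper_integral)
qed

theorem proposition2p3p2:
  fixes V :: "('x, 'e, 'j) vbundle"
    and W :: "('x, 'x \<times> (real \<Rightarrow> 'e \<Rightarrow> 'e), (real set \<times> 'j \<times> ('x \<Rightarrow> 'e set)) set) vbundle"
    and \<Theta> :: "('x \<Rightarrow> 'e set) set"
    and \<E> :: "('x \<Rightarrow> 'e) set"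
    and nrm :: "'x \<Rightarrow> 'e \<Rightarrow> real"
  assumes "Theta_structure V W Rplus \<Theta> \<E>"
    and "\<forall>x\<in>topspace (base_space V). reflexive_banach (stalk V x) (stalk_topology V x) (nrm x)"
    and "\<forall>x\<in>topspace (base_space V). S_family V \<Theta> \<E> x \<subseteq> Fpow (carrier (stalk V x))"
  shows "((\<forall>x\<in>topspace (base_space V). stalk_maps W x \<subseteq>
            {F \<in> carrier (cont_maps V \<Theta> \<E> Rplus x). \<forall>l>0.
              upper_integral Rplus (lebesgue_on {0..})
                (\<lambda>s. ennreal (exp (- l * s) * op_norm (stalk V x) (nrm x) (F s))) < \<infinity>})
          \<longrightarrow> (\<forall>x\<in>topspace (base_space V). stalk_maps W x \<subseteq>
                (\<Inter>l\<in>{0<..}. scalarly_L1 (exp_measure l) (LE V x) (LS_topology V \<Theta> \<E> x))))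
       \<and> ((\<forall>x\<in>topspace (base_space V). stalk_maps W x =
            {F \<in> carrier (cont_maps V \<Theta> \<E> Rplus x).
              bdd_above ((\<lambda>s. op_norm (stalk V x) (nrm x) (F s)) ` {0..})})
          \<longrightarrow> (\<forall>x\<in>topspace (base_space V). stalk_maps W x \<subseteq>
                (\<Inter>l\<in>{0<..}. scalarly_L1 (exp_measure l) (LE V x) (LS_topology V \<Theta> \<E> x)) \<and>
              contraction_semigroups V \<Theta> \<E> (nrm x) x \<subseteq> stalk_maps W x))"
proof (intro conjI impI ballI)
  fix x
  assume H: "\<forall>x\<in>topspace (base_space V). stalk_maps W x \<subseteq>
      {F \<in> carrier (cont_maps V \<Theta> \<E> Rplus x). \<forall>l>0.
        upper_integral Rplus (lebesgue_on {0..})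
          (\<lambda>s. ennreal (exp (- l * s) * op_norm (stalk V x) (nrm x) (F s))) < \<infinity>}"
    and x: "x \<in> topspace (base_space V)"
  show "stalk_maps W x \<subseteq> (\<Inter>l\<in>{0<..}. scalarly_L1 (exp_measure l) (LE V x) (LS_topology V \<Theta> \<E> x))"
  proof (intro subsetI INT_I)
    fix F and l :: real assume "F \<in> stalk_maps W x" "l \<in> {0<..}"
    then show "F \<in> scalarly_L1 (exp_measure l) (LE V x) (LS_topology V \<Theta> \<E> x)"
      using H x by (intro stalk_scalarly_L1[OF assms(1) x assms(2)[rule_format, OF x] assms(3)[rule_format, OF x]])
        fastforce+
  qed
next
  fix x
  assume H: "\<forall>x\<in>topspace (base_space V). stalk_maps W x =
      {F \<in> carrier (cont_maps V \<Theta> \<E> Rplus x).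
        bdd_above ((\<lambda>s. op_norm (stalk V x) (nrm x) (F s)) ` {0..})}"
    and x: "x \<in> topspace (base_space V)"
  show "stalk_maps W x \<subseteq> (\<Inter>l\<in>{0<..}. scalarly_L1 (exp_measure l) (LE V x) (LS_topology V \<Theta> \<E> x))"
  proof (intro subsetI INT_I)
    fix F and l :: real assume F: "F \<in> stalk_maps W x" and l: "l \<in> {0<..}"
    have F': "F \<in> carrier (cont_maps V \<Theta> \<E> Rplus x)"
      "bdd_above ((\<lambda>s. op_norm (stalk V x) (nrm x) (F s)) ` {0..})"
      using F bspec[OF H x] by auto
    then obtain K where "\<And>s. s \<ge> 0 \<Longrightarrow> op_norm (stalk V x) (nrm x) (F s) \<le> K"
      unfolding bdd_above_def by auto
    \<comment> \<open>A uniform bound on the operator norms makes the upper integral finite for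
      every \<open>l > 0\<close>, so the second claim reduces to the same lemma as the
      first.\<close>
    then show "F \<in> scalarly_L1 (exp_measure l) (LE V x) (LS_topology V \<Theta> \<E> x)"
      using F'(1) l
      by (intro stalk_scalarly_L1[OF assms(1) x assms(2)[rule_format, OF x] assms(3)[rule_format, OF x]]
          upper_integral_exp_bounded) auto
  qed
  have "bdd_above ((\<lambda>s. op_norm (stalk V x) (nrm x) (U s)) ` {0..})"
    if "U \<in> contraction_semigroups V \<Theta> \<E> (nrm x) x" for U
    using that by (intro bdd_aboveI2[where M = 1]) (simp add: contraction_semigroups_def)
  then show "contraction_semigroups V \<Theta> \<E> (nrm x) x \<subseteq> stalk_maps W x"
    unfolding bspec[OF H x] by (auto simp: contraction_semigroups_def)
qed

end
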